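(* Let $d\in\mathbb N_+$, ${\bf R}=(R_1,\dots,R_d)\in\mathbb R_+^d$ and $g({\bf R})=\frac{1}{1/R_1+\cdots+1/R_d}$. Then $$\lim_{n\to\infty} n^{g({\bf R})}\,a_n(I_d: W_2^{\bf R}(\mathbb T^d)\to L_2(\mathbb T^d))=\big(\mathrm{vol}(B^d_{2{\bf R}})\big)^{g({\bf R})},$$ where $\mathrm{vol}(B^d_{2{\bf R}})=2^d\frac{\Gamma(1+\frac{1}{2R_1})\cdots\Gamma(1+\frac{1}{2R_d})}{\Gamma(1+\frac{1}{2R_1}+\cdots+\frac{1}{2R_d})}$.
   Context: $B^d_{\bf S}(t)=\{{\bf x}\in\mathbb R^d:\sum_{j=1}^d|x_j|^{S_j}\le t\}$ for ${\bf S}\in\mathbb R_+^d$, $t>0$, and $B^d_{\bf S}=B^d_{\bf S}(1)$; $2{\bf R}=(2R_1,\dots,2R_d)$; vol is Lebesgue measure. $\mathbb T^d$ carries the normalized Lebesgue measure, $\hat f({\bf k})=(2\pi)^{-d}\int_{\mathbb T^d}f({\bf x})e^{-i{\bf k}\cdot{\bf x}}d{\bf x}$. $W_2^{\bf R}(\mathbb T^d)$ is the Hilbert space of $f\in L_2(\mathbb T^d)$ with norm $\big(\sum_{{\bf k}\in\mathbb Z^d}(1+\sum_{j=1}^d|k_j|^{2R_j})|\hat f({\bf k})|^2\big)^{1/2}$; $I_d$ is the identity embedding; $a_n(T)=\inf\{\|T-A\|:\operatorname{rank}A<n\}$ are the approximation numbers. *)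

theory Defs
  imports "HOL-Analysis.Analysis"
begin

text \<open>The torus T^d is realised as the cube [0,2pi]^d (a set of full-measure
representatives), functions on T^d as functions on this cube, and elements of
L_2 are handled up to equality almost everywhere on the cube.
The dimension d is CARD('d) for an index type 'd.\<close>

definition torus_cube :: "(real^'d) set" where
  "torus_cube = {x. \<forall>j. 0 \<le> x$j \<and> x$j \<le> 2*pi}"

definition L2T :: "(real^'d::finite \<Rightarrow> complex) set" where
  "L2T = {f. set_borel_measurable lborel torus_cube f \<and>
             set_integrable lborel torus_cube (\<lambda>x. (norm (f x))^2)}"

definition L2norm :: "(real^'d::finite \<Rightarrow> complex) \<Rightarrow> real" where
  "L2norm f = sqrt ((2*pi) powr (- real CARD('d)) *
                    (LINT x:torus_cube|lborel. (norm (f x))^2))"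

definition fcoeff :: "(real^'d::finite \<Rightarrow> complex) \<Rightarrow> int^'d \<Rightarrow> complex" where
  "fcoeff f k = complex_of_real ((2*pi) powr (- real CARD('d))) *
     (LINT x:torus_cube|lborel.
        f x * exp (- \<i> * complex_of_real (\<Sum>j\<in>UNIV. real_of_int (k$j) * x$j)))"

definition sob_weight :: "real^'d::finite \<Rightarrow> int^'d \<Rightarrow> real" where
  "sob_weight R k = 1 + (\<Sum>j\<in>UNIV. \<bar>real_of_int (k$j)\<bar> powr (2 * R$j))"

definition W2 :: "real^'d::finite \<Rightarrow> (real^'d \<Rightarrow> complex) set" where
  "W2 R = {f \<in> L2T. (\<lambda>k. sob_weight R k * (norm (fcoeff f k))^2) summable_on UNIV}"

definition W2norm :: "real^'d::finite \<Rightarrow> (real^'d \<Rightarrow> complex) \<Rightarrow> real" where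
  "W2norm R f = sqrt (\<Sum>\<^sub>\<infinity>k. sob_weight R k * (norm (fcoeff f k))^2)"

definition admissible_op ::
  "real^'d::finite \<Rightarrow> nat \<Rightarrow> ((real^'d \<Rightarrow> complex) \<Rightarrow> (real^'d \<Rightarrow> complex)) \<Rightarrow> bool" where
  "admissible_op R n A \<longleftrightarrow>
     (\<forall>f\<in>W2 R. A f \<in> L2T) \<and>
     (\<forall>f\<in>W2 R. \<forall>g\<in>W2 R. \<forall>a b::complex.
        AE x in lborel. x \<in> torus_cube \<longrightarrow>
          A (\<lambda>y. a * f y + b * g y) x = a * A f x + b * A g x) \<and>
     (\<exists>C. \<forall>f\<in>W2 R. L2norm (A f) \<le> C * W2norm R f) \<and>
     (\<exists>G. finite G \<and> card G < n \<and> G \<subseteq> L2T \<and>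
        (\<forall>f\<in>W2 R. \<exists>c. AE x in lborel. x \<in> torus_cube \<longrightarrow>
            A f x = (\<Sum>g\<in>G. c g * g x)))"

definition op_norm_diff ::
  "real^'d::finite \<Rightarrow> ((real^'d \<Rightarrow> complex) \<Rightarrow> (real^'d \<Rightarrow> complex)) \<Rightarrow> real" where
  "op_norm_diff R A = Sup {L2norm (\<lambda>x. f x - A f x) | f. f \<in> W2 R \<and> W2norm R f \<le> 1}"

definition approx_num :: "real^'d::finite \<Rightarrow> nat \<Rightarrow> real" where
  "approx_num R n = Inf {op_norm_diff R A | A. admissible_op R n A}"

definition ballS :: "real^'d::finite \<Rightarrow> (real^'d) set" where
  "ballS S = {x. (\<Sum>j\<in>UNIV. \<bar>x$j\<bar> powr (S$j)) \<le> 1}"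

definition gR :: "real^'d::finite \<Rightarrow> real" where
  "gR R = 1 / (\<Sum>j\<in>UNIV. 1 / R$j)"

end

theory Submission
  imports Defs
begin

text \<open>In the Fourier picture the embedding is diagonal with entries \<open>sob_weight R k powr (-1/2)\<close>, so its
approximation numbers are the decreasing rearrangement of these entries: truncating the Fourier series to
\<open>{k. sob_weight R k \<le> t}\<close> gives the upper bound (by Parseval), and an operator of smaller rank kills some
trigonometric sum with frequencies in this set, which gives the lower bound. The cardinality of the set is a
lattice point count in a dilated ball; after rescaling it is the volume of a discretised ball, which tends to
the volume \<open>V\<close> of the ball by dominated convergence, and inverting this count yields the limit. The formula
for \<open>V\<close> comes from integrating \<open>exp (- (\<Sum>j. \<bar>x j\<bar> powr p j))\<close> over the space in two ways: as a
product of Gamma integrals, and over the sublevel sets, whose volumes scale.\<close>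

section \<open>The volume of the generalised ball\<close>

text \<open>The Sobolev norm is built from Fourier coefficients, the target norm is an integral.
  Comparing them needs Parseval, whose hard half is completeness of the characters. For it the torus
  is embedded in \<open>complex^'d\<close> by x_j -> exp (i x_j): on the compact image,
  Stone-Weierstrass polynomials in the real coordinates are uniformly dense among continuous
  functions, and pulled back they are trigonometric sums. Exponents: with D = sum of 1/(2 R_j) =
  1/(2g), about V t^D weights are at most t, so the n-th weight is near (n/V)^(2g), and its power
  -1/2 times n^g is V^g. The count is never inverted literally: for b above V the threshold
  (n/b)^(2g) eventually admits fewer than n frequencies, for b below V more than n. This traps n^g
  a_n by powers b^g, and b may be taken arbitrarily close to V. Dominated convergence for the
  discretised balls can go wrong only on the boundary of the ball, which is why that boundary is
  shown to be null.\<close>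

lemma Basis_real_vec: "(Basis :: (real^'d::finite) set) = range (\<lambda>j. axis j 1)"
  by (auto simp: Basis_vec_def)

lemma prod_Basis_vec:
  "(\<Prod>b\<in>(Basis :: (real^'d::finite) set). f b) = (\<Prod>j\<in>UNIV. f (axis j 1))"
  unfolding Basis_real_vec by (subst prod.reindex) (auto simp: inj_on_def axis_eq_axis)

lemma measurable_vec_lambda_PiM [measurable]:
  "(\<lambda>f. \<chi> j. f j) \<in> (\<Pi>\<^sub>M j\<in>UNIV. (lborel::real measure)) \<rightarrow>\<^sub>M (borel :: (real^'d::finite) measure)"
  by (rule borel_measurable_euclidean_space[THEN iffD2]) (auto simp: Basis_real_vec inner_axis)

text \<open>A Borel measure giving every box the product of its side lengths is Lebesgue measure.
  The product form indexed by \<open>'d\<close> makes integrals of products of one-variable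
  functions factor.\<close>

lemma lborel_vec:
  "(lborel :: (real^'d::finite) measure) = distr (\<Pi>\<^sub>M j\<in>UNIV. lborel) borel (\<lambda>f. \<chi> j. f j)"
proof (rule lborel_eqI)
  interpret product_sigma_finite "\<lambda>j::'d. lborel :: real measure"
    by standard
  fix l u :: "real^'d" assume le: "\<And>b. b \<in> Basis \<Longrightarrow> l \<bullet> b \<le> u \<bullet> b"
  have le': "l $ j \<le> u $ j" for j
    using le[of "axis j 1"] by (simp add: inner_axis)
  have "emeasure (distr (\<Pi>\<^sub>M j\<in>UNIV. lborel) borel (\<lambda>f. \<chi> j. f j)) (box l u) =
      emeasure (\<Pi>\<^sub>M j\<in>UNIV. lborel) (Pi\<^sub>E UNIV (\<lambda>j. {l $ j <..< u $ j}))"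
    by (subst emeasure_distr)
       (auto simp: mem_box_cart space_PiM PiE_def Pi_def extensional_def intro!: arg_cong2[where f=emeasure])
  also have "\<dots> = (\<Prod>j\<in>UNIV. emeasure lborel {l $ j <..< u $ j})"
    by (rule emeasure_PiM) auto
  also have "\<dots> = (\<Prod>j\<in>UNIV. ennreal (u $ j - l $ j))"
    using le' by simp
  also have "\<dots> = ennreal (\<Prod>j\<in>UNIV. u $ j - l $ j)"
    using le' by (intro prod_ennreal) auto
  also have "(\<Prod>j\<in>UNIV. u $ j - l $ j) = (\<Prod>b\<in>Basis. (u - l) \<bullet> b)"
    by (simp add: prod_Basis_vec inner_axis)
  finally show "emeasure (distr (\<Pi>\<^sub>M j\<in>UNIV. lborel) borel (\<lambda>f. \<chi> j. f j)) (box l u) =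
      (\<Prod>b\<in>Basis. (u - l) \<bullet> b)" .
qed simp

lemma nn_integral_vec_prod:
  fixes f :: "'d::finite \<Rightarrow> real \<Rightarrow> ennreal"
  assumes [measurable]: "\<And>j. f j \<in> borel_measurable borel"
  shows "(\<integral>\<^sup>+x. (\<Prod>j\<in>UNIV. f j (x $ j)) \<partial>(lborel :: (real^'d) measure)) = (\<Prod>j\<in>UNIV. \<integral>\<^sup>+x. f j x \<partial>lborel)"
proof -
  interpret product_sigma_finite "\<lambda>j::'d. lborel :: real measure"
    by standard
  show ?thesis
    by (simp add: lborel_vec nn_integral_distr product_nn_integral_prod)
qed

lemma integral_vec_prod:
  fixes f :: "'d::finite \<Rightarrow> real \<Rightarrow> complex"
  assumes "\<And>j. integrable lborel (f j)"
  shows "(\<integral>x. (\<Prod>j\<in>UNIV. f j (x $ j)) \<partial>(lborel :: (real^'d) measure)) = (\<Prod>j\<in>UNIV. \<integral>x. f j x \<partial>lborel)"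
proof -
  interpret product_sigma_finite "\<lambda>j::'d. lborel :: real measure"
    by standard
  have [measurable]: "f j \<in> borel_measurable borel" for j
    using borel_measurable_integrable[OF assms[of j]] by simp
  show ?thesis
    by (simp add: lborel_vec integral_distr product_integral_prod assms)
qed

text \<open>Change of variables for a diagonal map. Each coordinate has its own factor because the
  balls are anisotropic: enlarging them scales direction j by a power depending on j.\<close>

lemma emeasure_lborel_vec_scale:
  fixes c :: "'d::finite \<Rightarrow> real"
  assumes c: "\<And>j. c j \<noteq> 0" and [measurable]: "A \<in> sets borel"
  shows "emeasure lborel A = ennreal (\<Prod>j\<in>UNIV. \<bar>c j\<bar>) * emeasure lborel {x. (\<chi> j. c j * x $ j) \<in> A}"
proof -
  \<comment> \<open>Rewrites the library's affine map, whose factors are indexed by basis vectors,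
    as the coordinatewise map; \<open>axis_index\<close> recovers the index from a basis
    vector.\<close>
  have T: "0 + (\<Sum>b\<in>Basis. (c (axis_index b) * (x \<bullet> b)) *\<^sub>R b) = (\<chi> j. c j * x $ j)" for x :: "real^'d"
    by (simp add: vec_lambda_eq_sum [where f="\<lambda>j t. c j * t"])
  have [measurable]: "(\<lambda>x::real^'d. \<chi> j. c j * x $ j) \<in> borel_measurable borel"
    by (rule borel_measurable_euclidean_space[THEN iffD2]) (auto simp: Basis_real_vec inner_axis)
  have "emeasure lborel A =
      emeasure (density (distr lborel borel (\<lambda>x::real^'d. \<chi> j. c j * x $ j)) (\<lambda>_. \<Prod>b\<in>(Basis::(real^'d) set). \<bar>c (axis_index b)\<bar>)) A"
    using lborel_affine_euclidean[of "\<lambda>b::real^'d. c (axis_index b)" 0] by (simp add: c T[simplified])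
  also have "\<dots> = ennreal (\<Prod>j\<in>UNIV. \<bar>c j\<bar>) * emeasure lborel ((\<lambda>x::real^'d. \<chi> j. c j * x $ j) -` A)"
    by (simp add: emeasure_density emeasure_distr prod_Basis_vec nn_integral_cmult)
  finally show ?thesis by (simp add: vimage_def)
qed

text \<open>Since exp(-c) is the integral of exp(-t) over t at least c, Fubini turns the left side
  into an integral of exp(-t) times the measure of the sublevel set at t. The power law then leaves
  the Gamma integral of t^D exp(-t). It is applied with D = 1/q on the line and with the sum of the
  1/p_j in the whole space.\<close>

lemma nn_integral_exp_neg_layer_cake:
  fixes \<Phi> :: "'a::euclidean_space \<Rightarrow> real"
  assumes [measurable]: "\<Phi> \<in> borel_measurable borel" and nn: "\<And>x. 0 \<le> \<Phi> x"
    and V: "\<And>t. t > 0 \<Longrightarrow> emeasure lborel {x. \<Phi> x \<le> t} = ennreal (t powr D) * V"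
    and D: "D > 0"
  shows "(\<integral>\<^sup>+x. ennreal (exp (- \<Phi> x)) \<partial>lborel) = ennreal (Gamma (1 + D)) * V"
proof -
  have exp_int: "ennreal (exp (- c)) = (\<integral>\<^sup>+t. ennreal (exp (- t)) * indicator {c..} t \<partial>lborel)" for c :: real
  proof -
    have "((\<lambda>t::real. - exp (- t)) \<longlongrightarrow> 0) at_top"
      using tendsto_minus[OF filterlim_compose[OF exp_at_bot filterlim_uminus_at_bot_at_top]] by simp
    then have "(\<integral>\<^sup>+t. ennreal (exp (- t)) * indicator {c..} t \<partial>lborel) = 0 - (- exp (- c))"
      by (intro nn_integral_FTC_atLeast) (auto intro!: derivative_eq_intros)
    then show ?thesis by simp
  qed
  have "(\<integral>\<^sup>+x. ennreal (exp (- \<Phi> x)) \<partial>lborel) =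
      (\<integral>\<^sup>+x. \<integral>\<^sup>+t. ennreal (exp (- t)) * indicator {\<Phi> x..} t \<partial>lborel \<partial>lborel)"
    by (intro nn_integral_cong exp_int)
  also have "\<dots> = (\<integral>\<^sup>+t. \<integral>\<^sup>+x. ennreal (exp (- t)) * indicator {\<Phi> x..} t \<partial>lborel \<partial>lborel)"
  proof (rule lborel_pair.Fubini'[symmetric])
    have "(\<lambda>(x, t). ennreal (exp (- t)) * indicator {\<Phi> x..} t) =
        (\<lambda>p. ennreal (exp (- snd p)) * indicator {p. \<Phi> (fst p) \<le> snd p} p)"
      by (auto simp: fun_eq_iff indicator_def)
    also have "\<dots> \<in> borel_measurable (lborel \<Otimes>\<^sub>M lborel)"
      by measurable
    finally show "(\<lambda>(x, t). ennreal (exp (- t)) * indicator {\<Phi> x..} t) \<in> borel_measurable (lborel \<Otimes>\<^sub>M lborel)" .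
  qed
  also have "\<dots> = (\<integral>\<^sup>+t. ennreal (exp (- t)) * emeasure lborel {x. \<Phi> x \<le> t} \<partial>lborel)"
  proof (rule nn_integral_cong)
    fix t :: real
    have "(\<integral>\<^sup>+x. ennreal (exp (- t)) * indicator {\<Phi> x..} t \<partial>lborel) =
        (\<integral>\<^sup>+x. ennreal (exp (- t)) * indicator {x. \<Phi> x \<le> t} x \<partial>lborel)"
      by (intro nn_integral_cong) (auto simp: indicator_def)
    also have "\<dots> = ennreal (exp (- t)) * emeasure lborel {x. \<Phi> x \<le> t}"
      by (subst nn_integral_cmult_indicator) auto
    finally show "(\<integral>\<^sup>+x. ennreal (exp (- t)) * indicator {\<Phi> x..} t \<partial>lborel) =
      ennreal (exp (- t)) * emeasure lborel {x. \<Phi> x \<le> t}" .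
  qed
  also have "\<dots> = (\<integral>\<^sup>+t. ennreal (indicator {0..} t * t powr ((1 + D) - 1) / exp t) * V \<partial>lborel)"
  proof (rule nn_integral_cong_AE)
    \<comment> \<open>The power law covers only t > 0 and for t < 0 the sublevel set is empty; the
      single value 0 is discarded as a null set.\<close>
    have "AE t in lborel. t \<noteq> (0::real)"
      by (rule AE_lborel_singleton)
    then show "AE t in lborel. ennreal (exp (- t)) * emeasure lborel {x. \<Phi> x \<le> t} =
      ennreal (indicator {0..} t * t powr ((1 + D) - 1) / exp t) * V"
    proof eventually_elim
      case (elim t)
      show ?case
      proof (cases "t > 0")
        case True
        then have "ennreal (exp (- t)) * ennreal (t powr D) = ennreal (indicator {0..} t * t powr ((1 + D) - 1) / exp t)"
          by (simp add: ennreal_mult[symmetric] exp_minus divide_inverse mult.commute)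
        with True show ?thesis
          by (simp only: V mult.assoc[symmetric])
      next
        case False
        with elim have "t < 0" by simp
        with nn have "{x. \<Phi> x \<le> t} = {}"
          by (auto simp: not_le intro: less_le_trans)
        with \<open>t < 0\<close> show ?thesis by simp
      qed
    qed
  qed
  also have "\<dots> = ennreal (Gamma (1 + D)) * V"
    using D by (subst nn_integral_multc) (auto simp: Gamma_conv_nn_integral_real)
  finally show ?thesis .
qed

text \<open>Stretching coordinate j by s^(1/p_j) multiplies every summand by s, so it maps the unit
  ball onto the sublevel set at s; the Jacobian is the product of these factors.\<close>

lemma emeasure_powr_sum_le:
  fixes p :: "real^'d::finite"
  assumes p: "\<And>j. p $ j > 0" and s: "s > 0"
  shows "emeasure lborel {x::real^'d. (\<Sum>j\<in>UNIV. \<bar>x $ j\<bar> powr (p $ j)) \<le> s} =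
    ennreal (s powr (\<Sum>j\<in>UNIV. 1 / p $ j)) * emeasure lborel (ballS p)"
proof -
  define c where "c j = s powr (1 / p $ j)" for j
  have c: "c j > 0" for j using s by (simp add: c_def)
  have "\<bar>c j * y\<bar> powr (p $ j) = s * \<bar>y\<bar> powr (p $ j)" for j y
    using c[of j] p[of j] s by (simp add: abs_mult powr_mult) (simp add: c_def powr_powr)
  then have "{x. (\<chi> j. c j * x $ j) \<in> {x::real^'d. (\<Sum>j\<in>UNIV. \<bar>x $ j\<bar> powr (p $ j)) \<le> s}} = ballS p"
    using s by (simp add: ballS_def sum_distrib_left[symmetric])
  moreover have "(\<Prod>j\<in>UNIV. \<bar>c j\<bar>) = s powr (\<Sum>j\<in>UNIV. 1 / p $ j)"
    using s by (simp add: c_def powr_sum)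
  moreover have "c j \<noteq> 0" for j using c[of j] by simp
  ultimately show ?thesis
    by (subst emeasure_lborel_vec_scale[of c]) auto
qed

lemma ballS_subset_cbox:
  fixes p :: "real^'d::finite"
  assumes p: "\<And>j. p $ j > 0"
  shows "ballS p \<subseteq> cbox (\<chi> j. -1) (\<chi> j. 1)"
proof
  fix x :: "real^'d" assume "x \<in> ballS p"
  then have *: "(\<Sum>j\<in>UNIV. \<bar>x $ j\<bar> powr (p $ j)) \<le> 1" by (simp add: ballS_def)
  have "\<bar>x $ j\<bar> \<le> 1" for j
  proof (rule ccontr)
    assume "\<not> \<bar>x $ j\<bar> \<le> 1"
    then have "1 < \<bar>x $ j\<bar> powr (p $ j)" using p[of j] by (simp add: gr_one_powr)
    also have "\<dots> \<le> (\<Sum>j\<in>UNIV. \<bar>x $ j\<bar> powr (p $ j))"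
      by (rule member_le_sum) auto
    finally show False using * by simp
  qed
  then show "x \<in> cbox (\<chi> j. -1) (\<chi> j. 1)"
    by (auto simp: mem_box_cart abs_le_iff minus_le_iff)
qed

lemma sets_ballS [measurable]: "ballS p \<in> sets borel"
  unfolding ballS_def by measurable

lemma emeasure_ballS_finite:
  assumes "\<And>j. p $ j > 0"
  shows "emeasure lborel (ballS p) < \<infinity>"
  using emeasure_mono[OF ballS_subset_cbox[OF assms], of lborel] emeasure_lborel_cbox_finite
  by (auto intro: le_less_trans)

text \<open>The sublevel set at t is an interval of length 2 t^(1/q), so the layer cake formula
  applies with volume constant 2. These factors 2 produce the power of 2 in the volume
  formula.\<close>

lemma nn_integral_exp_neg_powr:
  fixes q :: real
  assumes q: "q > 0"
  shows "(\<integral>\<^sup>+x. ennreal (exp (- (\<bar>x\<bar> powr q))) \<partial>lborel) = ennreal (2 * Gamma (1 + 1 / q))"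
proof -
  have "emeasure lborel {x::real. \<bar>x\<bar> powr q \<le> t} = ennreal (t powr (1 / q)) * 2" if t: "t > 0" for t
  proof -
    have iff: "\<bar>x\<bar> powr q \<le> t \<longleftrightarrow> \<bar>x\<bar> \<le> t powr (1 / q)" for x :: real
    proof -
      have "(t powr (1 / q)) powr q = t" using q t by (simp add: powr_powr)
      then show ?thesis
        using powr_mono2[of q "\<bar>x\<bar>" "t powr (1 / q)"] powr_less_mono2[of q "t powr (1 / q)" "\<bar>x\<bar>"] q
        by (cases "\<bar>x\<bar> \<le> t powr (1 / q)") auto
    qed
    have "{x::real. \<bar>x\<bar> powr q \<le> t} = {- (t powr (1 / q)) .. t powr (1 / q)}"
      unfolding iff by (auto simp: abs_le_iff)
    then show ?thesis
      by (simp add: ennreal_mult'[symmetric] ennreal_numeral[symmetric] mult.commute del: ennreal_numeral)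
  qed
  then have "(\<integral>\<^sup>+x. ennreal (exp (- (\<bar>x\<bar> powr q))) \<partial>lborel) = ennreal (Gamma (1 + 1 / q)) * 2"
    using q by (intro nn_integral_exp_neg_layer_cake) auto
  then show ?thesis
    using q by (simp add: ennreal_mult'[symmetric] ennreal_numeral[symmetric] mult.commute add_pos_pos less_imp_le del: ennreal_numeral)
qed

lemma measure_ballS:
  fixes p :: "real^'d::finite"
  assumes p: "\<And>j. p $ j > 0"
  shows "measure lborel (ballS p) =
    2 ^ CARD('d) * (\<Prod>j\<in>UNIV. Gamma (1 + 1 / p $ j)) / Gamma (1 + (\<Sum>j\<in>UNIV. 1 / p $ j))"
proof -
  let ?D = "\<Sum>j\<in>UNIV. 1 / p $ j"
  have D: "?D > 0" using p by (intro sum_pos) auto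
  have fin: "emeasure lborel (ballS p) = ennreal (measure lborel (ballS p))"
    using emeasure_ballS_finite[OF p] by (intro emeasure_eq_ennreal_measure) auto
  have "ennreal (Gamma (1 + ?D) * measure lborel (ballS p)) =
      (\<integral>\<^sup>+x. ennreal (exp (- (\<Sum>j\<in>UNIV. \<bar>x $ j\<bar> powr (p $ j)))) \<partial>(lborel :: (real^'d) measure))"
    using emeasure_powr_sum_le[OF p] D
    by (subst nn_integral_exp_neg_layer_cake[where D = ?D and V = "emeasure lborel (ballS p)"])
       (auto simp: fin ennreal_mult' sum_nonneg)
  also have "\<dots> = (\<integral>\<^sup>+x. (\<Prod>j\<in>UNIV. ennreal (exp (- (\<bar>x $ j\<bar> powr (p $ j))))) \<partial>(lborel :: (real^'d) measure))"
    by (intro nn_integral_cong) (simp add: sum_negf[symmetric] exp_sum prod_ennreal)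
  also have "\<dots> = (\<Prod>j\<in>UNIV. ennreal (2 * Gamma (1 + 1 / p $ j)))"
    by (subst nn_integral_vec_prod[where f = "\<lambda>j y. ennreal (exp (- (\<bar>y\<bar> powr (p $ j))))"])
       (simp_all add: nn_integral_exp_neg_powr p)
  also have "\<dots> = ennreal (\<Prod>j\<in>UNIV. 2 * Gamma (1 + 1 / p $ j))"
    using p by (intro prod_ennreal) (simp add: add_pos_pos Gamma_real_pos less_imp_le)
  finally have "Gamma (1 + ?D) * measure lborel (ballS p) = (\<Prod>j\<in>UNIV. 2 * Gamma (1 + 1 / p $ j))"
    using D p by (subst (asm) ennreal_inj)
      (auto intro!: mult_nonneg_nonneg prod_nonneg Gamma_real_nonneg add_nonneg_nonneg less_imp_le[OF Gamma_real_pos] simp: add_pos_pos less_imp_le)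
  moreover have "Gamma (1 + ?D) > 0" using D by (intro Gamma_real_pos) auto
  ultimately show ?thesis
    by (simp add: field_simps prod.distrib)
qed

lemma measure_ballS_pos:
  fixes p :: "real^'d::finite"
  assumes p: "\<And>j. p $ j > 0"
  shows "measure lborel (ballS p) > 0"
proof -
  have "(\<Sum>j\<in>UNIV. 1 / p $ j) > 0" using p by (intro sum_pos) auto
  then have "Gamma (1 + (\<Sum>j\<in>UNIV. 1 / p $ j)) > 0" by (intro Gamma_real_pos) auto
  moreover have "(\<Prod>j\<in>UNIV. Gamma (1 + 1 / p $ j)) > 0"
    using p by (intro prod_pos) (simp add: add_pos_pos Gamma_real_pos)
  ultimately show ?thesis by (simp add: measure_ballS[OF p])
qed

section \<open>Counting lattice points\<close>

lemma finite_int_vec_box: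
  fixes m :: "'d::finite \<Rightarrow> int"
  shows "finite {k::int^'d. \<forall>j. \<bar>k $ j\<bar> \<le> m j}"
proof -
  have "finite (vec_lambda ` (Pi\<^sub>E UNIV (\<lambda>j::'d. {- m j .. m j})))"
    by (intro finite_imageI finite_PiE) auto
  moreover have "{k::int^'d. \<forall>j. \<bar>k $ j\<bar> \<le> m j} \<subseteq> vec_lambda ` (Pi\<^sub>E UNIV (\<lambda>j. {- m j .. m j}))"
  proof
    fix k assume "k \<in> {k::int^'d. \<forall>j. \<bar>k $ j\<bar> \<le> m j}"
    then show "k \<in> vec_lambda ` (Pi\<^sub>E UNIV (\<lambda>j. {- m j .. m j}))"
      by (intro image_eqI[of _ _ "vec_nth k"]) (auto simp: abs_le_iff minus_le_iff)
  qed
  ultimately show ?thesis by (rule rev_finite_subset)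
qed

lemma finite_lattice_powr_sum:
  fixes p :: "real^'d::finite"
  assumes p: "\<And>j. p $ j > 0"
  shows "finite {k::int^'d. (\<Sum>j\<in>UNIV. \<bar>real_of_int (k $ j)\<bar> powr (p $ j)) \<le> s}"
proof (rule finite_subset[OF _ finite_int_vec_box])
  show "{k::int^'d. (\<Sum>j\<in>UNIV. \<bar>real_of_int (k $ j)\<bar> powr (p $ j)) \<le> s} \<subseteq>
     {k. \<forall>j. \<bar>k $ j\<bar> \<le> \<lfloor>s powr (1 / p $ j)\<rfloor>}"
  proof safe
    fix k :: "int^'d" and j assume k: "(\<Sum>j\<in>UNIV. \<bar>real_of_int (k $ j)\<bar> powr (p $ j)) \<le> s"
    have "\<bar>real_of_int (k $ j)\<bar> powr (p $ j) \<le> (\<Sum>j\<in>UNIV. \<bar>real_of_int (k $ j)\<bar> powr (p $ j))"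
      by (rule member_le_sum) auto
    with k have "(\<bar>real_of_int (k $ j)\<bar> powr (p $ j)) powr (1 / p $ j) \<le> s powr (1 / p $ j)"
      using p[of j] by (intro powr_mono2) auto
    moreover have "(\<bar>real_of_int (k $ j)\<bar> powr (p $ j)) powr (1 / p $ j) = \<bar>real_of_int (k $ j)\<bar>"
      using p[of j] by (simp add: powr_powr)
    ultimately show "\<bar>k $ j\<bar> \<le> \<lfloor>s powr (1 / p $ j)\<rfloor>" by (simp add: le_floor_iff)
  qed
qed

lemma emeasure_unit_cell:
  fixes k :: "int^'d::finite"
  shows "emeasure lborel {x::real^'d. \<forall>j. \<lfloor>x $ j\<rfloor> = k $ j} = 1"
proof -
  have "emeasure lborel {x::real^'d. \<forall>j. \<lfloor>x $ j\<rfloor> = k $ j} =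
      (\<integral>\<^sup>+x. indicator {x::real^'d. \<forall>j. \<lfloor>x $ j\<rfloor> = k $ j} x \<partial>lborel)"
    by (subst nn_integral_indicator) auto
  also have "\<dots> = (\<integral>\<^sup>+x. (\<Prod>j\<in>UNIV. indicator {of_int (k $ j) ..< of_int (k $ j) + 1} (x $ j)) \<partial>(lborel :: (real^'d) measure))"
  proof (intro nn_integral_cong)
    fix x :: "real^'d"
    have "\<lfloor>x $ j\<rfloor> = k $ j \<longleftrightarrow> x $ j \<in> {of_int (k $ j) ..< of_int (k $ j) + 1}" for j
      by (simp add: floor_eq_iff)
    then show "indicator {x::real^'d. \<forall>j. \<lfloor>x $ j\<rfloor> = k $ j} x =
        (\<Prod>j\<in>UNIV. indicator {of_int (k $ j) ..< of_int (k $ j) + 1} (x $ j) :: ennreal)"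
      by (auto simp: indicator_def prod_zero_iff)
  qed
  also have "\<dots> = (\<Prod>j\<in>UNIV. \<integral>\<^sup>+x. indicator {of_int (k $ j) ..< of_int (k $ j) + 1} x \<partial>(lborel :: real measure))"
    by (rule nn_integral_vec_prod) auto
  also have "\<dots> = 1" by simp
  finally show ?thesis .
qed

text \<open>Turns a count into a volume: the half-open unit cells with lower corners in
  \<open>K\<close> are disjoint and have measure 1 each.\<close>

lemma emeasure_floor_preimage:
  fixes K :: "(int^'d::finite) set"
  assumes "finite K"
  shows "emeasure lborel {x::real^'d. (\<chi> j. \<lfloor>x $ j\<rfloor>) \<in> K} = card K"
proof -
  have "{x::real^'d. (\<chi> j. \<lfloor>x $ j\<rfloor>) \<in> K} = (\<Union>k\<in>K. {x. \<forall>j. \<lfloor>x $ j\<rfloor> = k $ j})"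
    by (auto simp: vec_eq_iff)
  also have "emeasure lborel \<dots> = (\<Sum>k\<in>K. emeasure lborel {x::real^'d. \<forall>j. \<lfloor>x $ j\<rfloor> = k $ j})"
    using assms by (intro sum_emeasure[symmetric]) (auto simp: disjoint_family_on_def vec_eq_iff)
  finally show ?thesis by (simp add: emeasure_unit_cell)
qed

text \<open>For each r < 1 the level set lies in the ball minus the sublevel set at r, whose measure
  is V - r^D V by scaling; this tends to 0 as r increases to 1.\<close>

lemma powr_sum_eq_1_null:
  fixes p :: "real^'d::finite"
  assumes p: "\<And>j. p $ j > 0"
  shows "AE x in lborel. (\<Sum>j\<in>UNIV. \<bar>x $ j\<bar> powr (p $ j)) \<noteq> 1"
proof -
  define \<Phi> where "\<Phi> x = (\<Sum>j\<in>UNIV. \<bar>x $ j\<bar> powr (p $ j))" for x :: "real^'d"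
  have [measurable]: "\<Phi> \<in> borel_measurable borel" unfolding \<Phi>_def by measurable
  define D where "D = (\<Sum>j\<in>UNIV. 1 / p $ j)"
  define V where "V = measure lborel (ballS p)"
  have fin: "ballS p \<in> fmeasurable lborel"
    using emeasure_ballS_finite[OF p] by (intro fmeasurableI) auto
  have sub: "measure lborel {x. \<Phi> x \<le> r} = r powr D * V" if "r > 0" for r
    using emeasure_powr_sum_le[OF p that] unfolding measure_def D_def V_def \<Phi>_def
    by (simp add: enn2real_mult)
  have le: "measure lborel {x. \<Phi> x = 1} \<le> V - r powr D * V" if "0 < r" "r < 1" for r
  proof -
    have s: "{x. \<Phi> x \<le> r} \<subseteq> ballS p" using that by (auto simp: \<Phi>_def ballS_def)
    have fin2: "{x. \<Phi> x \<le> r} \<in> fmeasurable lborel"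
      by (rule fmeasurableI2[OF fin s]) auto
    have "measure lborel {x. \<Phi> x = 1} \<le> measure lborel (ballS p - {x. \<Phi> x \<le> r})"
      using that by (intro measure_mono_fmeasurable fmeasurable.Diff fin fin2) (auto simp: ballS_def \<Phi>_def)
    also have "\<dots> = measure lborel (ballS p) - measure lborel {x. \<Phi> x \<le> r}"
      using s fin fin2 by (intro measure_Diff) (auto simp: fmeasurable_def)
    finally show ?thesis using that by (simp add: sub V_def)
  qed
  have "((\<lambda>r. V - r powr D * V) \<longlongrightarrow> V - 1 powr D * V) (at_left 1)"
    by (intro tendsto_intros) auto
  moreover have "eventually (\<lambda>r. measure lborel {x. \<Phi> x = 1} \<le> V - r powr D * V) (at_left 1)"
    using eventually_at_left_real[of 0 "1::real"] by (auto elim!: eventually_mono intro: le)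
  ultimately have "measure lborel {x. \<Phi> x = 1} \<le> V - 1 powr D * V"
    by (intro tendsto_lowerbound) auto
  then have "measure lborel {x. \<Phi> x = 1} = 0"
    by (simp add: order_antisym)
  moreover have "{x. \<Phi> x = 1} \<in> fmeasurable lborel"
    by (rule fmeasurableI2[OF fin]) (auto simp: \<Phi>_def ballS_def)
  ultimately have "{x. \<Phi> x = 1} \<in> null_sets lborel"
    by (auto simp: null_sets_def fmeasurable_def emeasure_eq_ennreal_measure)
  then show ?thesis unfolding \<Phi>_def[symmetric]
    by (rule AE_I') auto
qed

text \<open>Rounding down to the grid of spacing 1/c moves a point by less than 1/c, which tends to
  0.\<close>

lemma floor_scale_tendsto:
  fixes c :: "'a \<Rightarrow> real"
  assumes "filterlim c at_top F"
  shows "((\<lambda>s. of_int \<lfloor>c s * y\<rfloor> / c s) \<longlongrightarrow> y) F"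
proof (rule tendsto_sandwich)
  have pos: "\<forall>\<^sub>F s in F. c s > 0" using assms by (simp add: filterlim_at_top_dense)
  show "\<forall>\<^sub>F s in F. y - 1 / c s \<le> of_int \<lfloor>c s * y\<rfloor> / c s"
    using pos
  proof eventually_elim
    case (elim s)
    have "c s * y - 1 \<le> of_int \<lfloor>c s * y\<rfloor>" by linarith
    then have "(c s * y - 1) / c s \<le> of_int \<lfloor>c s * y\<rfloor> / c s" using elim by (intro divide_right_mono) auto
    then show ?case using elim by (simp add: diff_divide_distrib)
  qed
  show "\<forall>\<^sub>F s in F. of_int \<lfloor>c s * y\<rfloor> / c s \<le> y"
    using pos by eventually_elim (simp add: divide_le_eq mult.commute)
  have "((\<lambda>s. 1 / c s) \<longlongrightarrow> 0) F"
    using tendsto_inverse_0_at_top[OF assms] by (simp add: inverse_eq_divide)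
  from tendsto_diff[OF tendsto_const this, of y] show "((\<lambda>s. y - 1 / c s) \<longlongrightarrow> y) F" by simp
qed simp

lemma filterlim_powr_at_top:
  fixes a :: real
  assumes "a > 0"
  shows "filterlim (\<lambda>x. x powr a) at_top at_top"
proof -
  have "filterlim (\<lambda>x. exp (a * ln x)) at_top at_top"
    using assms
    by (intro filterlim_compose[OF exp_at_top] filterlim_tendsto_pos_mult_at_top[OF tendsto_const _ ln_at_top])
  moreover have "\<forall>\<^sub>F x in at_top. exp (a * ln x) = x powr a"
    using eventually_gt_at_top[of 0] by eventually_elim (simp add: powr_def)
  ultimately show ?thesis by (rule filterlim_cong[OF refl refl, THEN iffD1, rotated])
qed

theorem lattice_count_powr_sum:
  fixes p :: "real^'d::finite"
  assumes p: "\<And>j. p $ j > 0"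
  shows "((\<lambda>s. real (card {k::int^'d. (\<Sum>j\<in>UNIV. \<bar>real_of_int (k $ j)\<bar> powr (p $ j)) \<le> s})
      / s powr (\<Sum>j\<in>UNIV. 1 / p $ j)) \<longlongrightarrow> measure lborel (ballS p)) at_top"
proof -
  define \<Phi> where "\<Phi> x = (\<Sum>j\<in>UNIV. \<bar>x $ j\<bar> powr (p $ j))" for x :: "real^'d"
  have [measurable]: "\<Phi> \<in> borel_measurable borel" unfolding \<Phi>_def by measurable
  define D where "D = (\<Sum>j\<in>UNIV. 1 / p $ j)"
  define K where "K s = {k::int^'d. (\<Sum>j\<in>UNIV. \<bar>real_of_int (k $ j)\<bar> powr (p $ j)) \<le> s}" for s
  define c where "c j s = s powr (1 / p $ j)" for j s
  \<comment> \<open>\<open>r s x\<close> rounds x down to the grid with spacing 1 /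
    \<open>c j s\<close> in direction j, so \<open>A s\<close> is a union of grid cells
    approximating the unit ball. Undoing the scaling matches its cells with the lattice points in
    \<open>K s\<close>.\<close>
  define r where "r s x = (\<chi> j. of_int \<lfloor>c j s * x $ j\<rfloor> / c j s)" for s and x :: "real^'d"
  define A where "A s = {x. \<Phi> (r s x) \<le> 1}" for s
  have c_pos: "c j s > 0" if "s > 0" for j s using that by (simp add: c_def)
  have [measurable]: "r s \<in> borel_measurable borel" for s
    unfolding r_def by (rule borel_measurable_euclidean_space[THEN iffD2]) (auto simp: Basis_real_vec inner_axis)
  have [measurable]: "A s \<in> sets borel" for s unfolding A_def by measurable
  have count: "real (card (K s)) = s powr D * measure lborel (A s)" if s: "s > 0" for s
  proof -
    have scale: "\<bar>c j s * y\<bar> powr (p $ j) = s * \<bar>y\<bar> powr (p $ j)" for j y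
      using c_pos[OF s, of j] p[of j] s by (simp add: abs_mult powr_mult) (simp add: c_def powr_powr)
    have "\<bar>real_of_int \<lfloor>c j s * y\<rfloor>\<bar> powr (p $ j) = s * \<bar>of_int \<lfloor>c j s * y\<rfloor> / c j s\<bar> powr (p $ j)" for j y
      using c_pos[OF s, of j] by (subst scale[symmetric]) simp
    then have eq: "(\<chi> j. \<lfloor>c j s * x $ j\<rfloor>) \<in> K s \<longleftrightarrow> x \<in> A s" for x
      using s by (simp add: K_def A_def r_def \<Phi>_def sum_distrib_left[symmetric])
    have [measurable]: "{x::real^'d. (\<chi> j. \<lfloor>x $ j\<rfloor>) \<in> K s} \<in> sets borel"
    proof -
      have "{x::real^'d. (\<chi> j. \<lfloor>x $ j\<rfloor>) \<in> K s} =
          {x. (\<Sum>j\<in>UNIV. \<bar>real_of_int \<lfloor>x $ j\<rfloor>\<bar> powr (p $ j)) \<le> s}"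
        by (simp add: K_def)
      then show ?thesis by simp
    qed
    have "ennreal (real (card (K s))) = emeasure lborel {x::real^'d. (\<chi> j. \<lfloor>x $ j\<rfloor>) \<in> K s}"
      using emeasure_floor_preimage[of "K s"] finite_lattice_powr_sum[OF p, of s]
      by (simp add: K_def ennreal_of_nat_eq_real_of_nat)
    also have "\<dots> = ennreal (\<Prod>j\<in>UNIV. \<bar>c j s\<bar>) * emeasure lborel (A s)"
      using c_pos[OF s] by (subst emeasure_lborel_vec_scale[of "\<lambda>j. c j s"]) (auto simp: eq less_imp_neq[THEN not_sym])
    also have "(\<Prod>j\<in>UNIV. \<bar>c j s\<bar>) = s powr D"
      using s by (simp add: c_def powr_sum D_def)
    finally have "enn2real (ennreal (real (card (K s)))) = enn2real (ennreal (s powr D) * emeasure lborel (A s))"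
      by simp
    then show ?thesis by (simp add: enn2real_mult measure_def)
  qed
  have c_lim: "filterlim (c j) at_top at_top" for j
    unfolding c_def using p[of j] by (intro filterlim_powr_at_top) auto
  have "((\<lambda>s. integral\<^sup>L lborel (indicator (A s) :: _ \<Rightarrow> real)) \<longlongrightarrow> integral\<^sup>L lborel (indicator (ballS p))) at_top"
  proof (rule integral_dominated_convergence_at_top)
    \<comment> \<open>Once s is at least 1 the grid spacing is at most 1. A point of
      \<open>A s\<close> is then within 1 of its rounded point, which lies in the ball and hence in
      the cube from -1 to 1; this explains the bound 2.\<close>
    show "integrable lborel (indicator (cbox (\<chi> j. -2) (\<chi> j. 2) :: (real^'d) set) :: _ \<Rightarrow> real)"
      by (intro integrable_real_indicator emeasure_lborel_cbox_finite) auto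
    show "AE x in lborel. ((\<lambda>s. indicator (A s) x) \<longlongrightarrow> (indicator (ballS p) x :: real)) at_top"
      using powr_sum_eq_1_null[OF p]
    proof eventually_elim
      case (elim x)
      have lim: "((\<lambda>s. \<Phi> (r s x)) \<longlongrightarrow> \<Phi> x) at_top"
        unfolding \<Phi>_def r_def vec_lambda_beta
        by (intro tendsto_sum tendsto_powr' tendsto_rabs floor_scale_tendsto c_lim tendsto_const) (simp add: p)
      \<comment> \<open>Away from the level 1 the strict inequality for the limit passes to
        \<open>\<Phi> (r s x)\<close> for large s, so the indicators are eventually equal, not
        merely close.\<close>
      consider "\<Phi> x < 1" | "\<Phi> x > 1" using elim by (fastforce simp: \<Phi>_def)
      then show ?case
      proof cases
        case 1
        have "\<forall>\<^sub>F s in at_top. indicator (A s) x = (indicator (ballS p) x :: real)"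
          using order_tendstoD(2)[OF lim 1] by eventually_elim (use 1 in \<open>auto simp: A_def ballS_def \<Phi>_def[symmetric]\<close>)
        then show ?thesis by (rule tendsto_eventually)
      next
        case 2
        have "\<forall>\<^sub>F s in at_top. indicator (A s) x = (indicator (ballS p) x :: real)"
          using order_tendstoD(1)[OF lim 2] by eventually_elim (use 2 in \<open>auto simp: A_def ballS_def \<Phi>_def[symmetric]\<close>)
        then show ?thesis by (rule tendsto_eventually)
      qed
    qed
    show "\<forall>\<^sub>F s in at_top. AE x in lborel. norm (indicator (A s) x :: real) \<le> indicator (cbox (\<chi> j. -2) (\<chi> j. 2)) x"
      using eventually_ge_at_top[of 1]
    proof eventually_elim
      case (elim s)
      have "A s \<subseteq> cbox (\<chi> j. -2) (\<chi> j. 2)"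
      proof
        fix x assume "x \<in> A s"
        then have "r s x \<in> ballS p" by (simp add: A_def ballS_def \<Phi>_def)
        with ballS_subset_cbox[OF p] have "r s x \<in> cbox (\<chi> j. -1) (\<chi> j. 1)" by blast
        then have b: "-1 \<le> of_int \<lfloor>c j s * x $ j\<rfloor> / c j s" "of_int \<lfloor>c j s * x $ j\<rfloor> / c j s \<le> 1" for j
          by (auto simp: mem_box_cart r_def)
        have "-2 \<le> x $ j \<and> x $ j \<le> 2" for j
        proof -
          have c1: "c j s \<ge> 1" using elim p[of j] by (simp add: c_def ge_one_powr_ge_zero)
          have "of_int \<lfloor>c j s * x $ j\<rfloor> \<le> c j s" "- c j s \<le> of_int \<lfloor>c j s * x $ j\<rfloor>"
            using b[of j] c1 by (auto simp: divide_le_eq le_divide_eq)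
          then have "c j s * x $ j \<le> c j s * 2" "c j s * (-2) \<le> c j s * x $ j"
            using c1 by linarith+
          with c1 show ?thesis by (simp only: mult_le_cancel_left_pos)
        qed
        then show "x \<in> cbox (\<chi> j. -2) (\<chi> j. 2)" by (simp add: mem_box_cart)
      qed
      then show ?case by (auto simp: indicator_def)
    qed
  qed auto
  then have "((\<lambda>s. measure lborel (A s)) \<longlongrightarrow> measure lborel (ballS p)) at_top" by simp
  moreover have "\<forall>\<^sub>F s in at_top. measure lborel (A s) = real (card (K s)) / s powr D"
    using eventually_gt_at_top[of 0] by eventually_elim (simp add: count)
  ultimately show ?thesis unfolding K_def D_def by (rule Lim_transform_eventually)
qed

section \<open>Density of polynomials in L2 of a compactly supported measure\<close>

lemma norm_add_power2_le:
  fixes a b :: "'a::real_normed_vector"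
  shows "(norm (a + b))\<^sup>2 \<le> 2 * (norm a)\<^sup>2 + 2 * (norm b)\<^sup>2"
proof -
  have "(norm (a + b))\<^sup>2 \<le> (norm a + norm b)\<^sup>2"
    by (intro power_mono norm_triangle_ineq) auto
  also have "\<dots> \<le> 2 * (norm a)\<^sup>2 + 2 * (norm b)\<^sup>2"
    using sum_squares_bound[of "norm a" "norm b"] by (simp add: power2_sum)
  finally show ?thesis .
qed

text \<open>Polynomials in the real coordinates of the argument. On \<open>complex^'d\<close> these
  contain the conjugate coordinates as well, as Stone-Weierstrass requires.\<close>

definition complex_polynomial :: "('a::real_normed_vector \<Rightarrow> complex) \<Rightarrow> bool" where
  "complex_polynomial P \<longleftrightarrow> real_polynomial_function (\<lambda>z. Re (P z)) \<and> real_polynomial_function (\<lambda>z. Im (P z))"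

lemma complex_polynomial_add:
  "complex_polynomial P \<Longrightarrow> complex_polynomial Q \<Longrightarrow> complex_polynomial (\<lambda>z. P z + Q z)"
  by (auto simp: complex_polynomial_def real_polynomial_function.intros(3))

lemma complex_polynomial_cmult:
  "complex_polynomial P \<Longrightarrow> complex_polynomial (\<lambda>z. c * P z)"
  by (auto simp: complex_polynomial_def intro!: real_polynomial_function.intros(3) real_polynomial_function_diff
      real_polynomial_function.intros(4) real_polynomial_function.intros(2))

lemma complex_polynomial_measurable:
  fixes P :: "'a::euclidean_space \<Rightarrow> complex"
  assumes "complex_polynomial P"
  shows "P \<in> borel_measurable borel"
proof -
  have "continuous_on UNIV (\<lambda>z. Re (P z))" "continuous_on UNIV (\<lambda>z. Im (P z))"
    using assms continuous_on_polymonial_function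
    by (auto simp: complex_polynomial_def real_polynomial_function_eq)
  then show ?thesis
    by (subst borel_measurable_complex_iff) (auto intro: borel_measurable_continuous_onI)
qed

text \<open>Abstracts the push-forward of the torus measure to \<open>complex^'d\<close>.
  Stone-Weierstrass controls errors only on the compact set \<open>T\<close>, and
  \<open>AE_T\<close> makes this enough for integrals.\<close>

locale compactly_supported_measure = finite_measure \<nu> for \<nu> :: "'a::euclidean_space measure" +
  fixes T
  assumes sets_eq [measurable_cong]: "sets \<nu> = sets borel"
    and compact_T: "compact T" and AE_T: "AE z in \<nu>. z \<in> T"
begin

text \<open>The nonnegative integral is used so that no integrability has to be known in advance:
  the strict bound already contains finiteness.\<close>

definition L2_approx :: "('a \<Rightarrow> complex) \<Rightarrow> bool" where
  "L2_approx h \<longleftrightarrow> (\<forall>\<epsilon>>0. \<exists>P. complex_polynomial P \<and>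
      (\<integral>\<^sup>+z. ennreal ((norm (h z - P z))\<^sup>2) \<partial>\<nu>) < ennreal \<epsilon>)"

text \<open>Takes the place of the triangle inequality for the L2 norm. Each half contributes less
  than 2 times a quarter of \<open>\<epsilon>\<close>, by |a + b|^2 at most 2|a|^2 + 2|b|^2.\<close>

lemma nn_integral_norm_add_power2_less:
  assumes [measurable]: "f \<in> borel_measurable borel" "g \<in> borel_measurable borel"
    and f: "(\<integral>\<^sup>+z. ennreal ((norm (f z))\<^sup>2) \<partial>\<nu>) < ennreal (\<epsilon> / 4)"
    and g: "(\<integral>\<^sup>+z. ennreal ((norm (g z))\<^sup>2) \<partial>\<nu>) < ennreal (\<epsilon> / 4)"
  shows "(\<integral>\<^sup>+z. ennreal ((norm (f z + g z :: complex))\<^sup>2) \<partial>\<nu>) < ennreal \<epsilon>"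
proof -
  have \<epsilon>: "\<epsilon> > 0" using f by (metis ennreal_neg leI divide_nonpos_pos not_less_zero zero_less_numeral)
  have "(\<integral>\<^sup>+z. ennreal ((norm (f z + g z))\<^sup>2) \<partial>\<nu>) \<le>
      (\<integral>\<^sup>+z. ennreal 2 * ennreal ((norm (f z))\<^sup>2) + ennreal 2 * ennreal ((norm (g z))\<^sup>2) \<partial>\<nu>)"
    by (intro nn_integral_mono)
       (simp only: ennreal_mult'[symmetric] ennreal_plus[symmetric] norm_add_power2_le ennreal_leI
          mult_nonneg_nonneg zero_le_power2 zero_le_numeral)
  also have "\<dots> = ennreal 2 * (\<integral>\<^sup>+z. ennreal ((norm (f z))\<^sup>2) \<partial>\<nu>) + ennreal 2 * (\<integral>\<^sup>+z. ennreal ((norm (g z))\<^sup>2) \<partial>\<nu>)"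
    by (subst nn_integral_add) (simp_all add: nn_integral_cmult)
  also have "\<dots> < ennreal 2 * ennreal (\<epsilon> / 4) + ennreal 2 * ennreal (\<epsilon> / 4)"
    using f g by (intro add_strict_mono ennreal_mult_strict_left_mono) auto
  also have "\<dots> = ennreal (2 * (\<epsilon> / 4) + 2 * (\<epsilon> / 4))"
    using \<epsilon> by (simp only: ennreal_mult'[symmetric] ennreal_plus[symmetric] mult_nonneg_nonneg zero_le_numeral divide_nonneg_nonneg less_imp_le)
  finally show ?thesis by simp
qed

lemma L2_approx_trans:
  assumes [measurable]: "h \<in> borel_measurable borel"
    and approx: "\<And>\<epsilon>. \<epsilon> > 0 \<Longrightarrow> \<exists>g. g \<in> borel_measurable borel \<and> L2_approx g \<and>
       (\<integral>\<^sup>+z. ennreal ((norm (h z - g z))\<^sup>2) \<partial>\<nu>) < ennreal \<epsilon>"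
  shows "L2_approx h"
  unfolding L2_approx_def
proof (intro allI impI)
  fix \<epsilon> :: real assume \<epsilon>: "\<epsilon> > 0"
  then obtain g where [measurable]: "g \<in> borel_measurable borel" and g: "L2_approx g"
    and hg: "(\<integral>\<^sup>+z. ennreal ((norm (h z - g z))\<^sup>2) \<partial>\<nu>) < ennreal (\<epsilon> / 4)"
    using approx[of "\<epsilon> / 4"] by auto
  obtain P where P: "complex_polynomial P" and gP: "(\<integral>\<^sup>+z. ennreal ((norm (g z - P z))\<^sup>2) \<partial>\<nu>) < ennreal (\<epsilon> / 4)"
    using g \<epsilon> unfolding L2_approx_def by (meson divide_pos_pos zero_less_numeral)
  note [measurable] = complex_polynomial_measurable[OF P]
  have "(\<integral>\<^sup>+z. ennreal ((norm ((h z - g z) + (g z - P z)))\<^sup>2) \<partial>\<nu>) < ennreal \<epsilon>"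
    using hg gP by (intro nn_integral_norm_add_power2_less) auto
  then show "\<exists>P. complex_polynomial P \<and> (\<integral>\<^sup>+z. ennreal ((norm (h z - P z))\<^sup>2) \<partial>\<nu>) < ennreal \<epsilon>"
    using P by (intro exI[of _ P]) simp
qed

text \<open>Dominated convergence turns pointwise convergence into L2 convergence, and
  approximability is closed under the latter.\<close>

lemma L2_approx_limit:
  fixes s :: "nat \<Rightarrow> 'a \<Rightarrow> complex"
  assumes [measurable]: "h \<in> borel_measurable borel" "\<And>i. s i \<in> borel_measurable borel"
    and s: "\<And>i. L2_approx (s i)"
    and lim: "\<And>z. (\<lambda>i. s i z) \<longlonglongrightarrow> h z"
    and [measurable]: "w \<in> borel_measurable borel" and w: "\<And>i z. (norm (h z - s i z))\<^sup>2 \<le> w z" "(\<integral>\<^sup>+z. ennreal (w z) \<partial>\<nu>) < \<infinity>"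
  shows "L2_approx h"
proof (rule L2_approx_trans)
  have "(\<lambda>i. \<integral>\<^sup>+z. ennreal ((norm (h z - s i z))\<^sup>2) \<partial>\<nu>) \<longlonglongrightarrow> (\<integral>\<^sup>+z. 0 \<partial>\<nu>)"
  proof (rule nn_integral_dominated_convergence[where w = "\<lambda>z. ennreal (w z)"])
    show "AE z in \<nu>. (\<lambda>i. ennreal ((norm (h z - s i z))\<^sup>2)) \<longlonglongrightarrow> 0"
    proof (rule AE_I2)
      fix z
      have "(\<lambda>i. (norm (h z - s i z))\<^sup>2) \<longlonglongrightarrow> (norm (h z - h z))\<^sup>2"
        by (intro tendsto_intros lim)
      then show "(\<lambda>i. ennreal ((norm (h z - s i z))\<^sup>2)) \<longlonglongrightarrow> 0"
        using tendsto_ennrealI by fastforce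
    qed
  qed (use w in \<open>auto intro!: ennreal_leI\<close>)
  then have lim0: "(\<lambda>i. \<integral>\<^sup>+z. ennreal ((norm (h z - s i z))\<^sup>2) \<partial>\<nu>) \<longlonglongrightarrow> 0" by simp
  fix \<epsilon> :: real assume "\<epsilon> > 0"
  then have "\<forall>\<^sub>F i in sequentially. (\<integral>\<^sup>+z. ennreal ((norm (h z - s i z))\<^sup>2) \<partial>\<nu>) < ennreal \<epsilon>"
    by (intro order_tendstoD(2)[OF lim0]) simp
  then obtain i where "(\<integral>\<^sup>+z. ennreal ((norm (h z - s i z))\<^sup>2) \<partial>\<nu>) < ennreal \<epsilon>"
    by (auto simp: eventually_sequentially)
  then show "\<exists>g. g \<in> borel_measurable borel \<and> L2_approx g \<and> (\<integral>\<^sup>+z. ennreal ((norm (h z - g z))\<^sup>2) \<partial>\<nu>) < ennreal \<epsilon>"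
    using s by (intro exI[of _ "s i"]) simp
qed fact

lemma L2_approx_cmult:
  assumes [measurable]: "h \<in> borel_measurable borel" and h: "L2_approx h"
  shows "L2_approx (\<lambda>z. c * h z)"
  unfolding L2_approx_def
proof (intro allI impI)
  fix \<epsilon> :: real assume \<epsilon>: "\<epsilon> > 0"
  \<comment> \<open>The summand 1 covers c = 0 and makes the final estimate strict.\<close>
  define \<delta> where "\<delta> = \<epsilon> / ((norm c)\<^sup>2 + 1)"
  have "\<delta> > 0" using \<epsilon> by (simp add: \<delta>_def add_nonneg_pos)
  then obtain P where P: "complex_polynomial P" and hP: "(\<integral>\<^sup>+z. ennreal ((norm (h z - P z))\<^sup>2) \<partial>\<nu>) < ennreal \<delta>"
    using h unfolding L2_approx_def by blast
  note [measurable] = complex_polynomial_measurable[OF P]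
  have "(\<integral>\<^sup>+z. ennreal ((norm (c * h z - c * P z))\<^sup>2) \<partial>\<nu>) = ennreal ((norm c)\<^sup>2) * (\<integral>\<^sup>+z. ennreal ((norm (h z - P z))\<^sup>2) \<partial>\<nu>)"
    by (subst nn_integral_cmult[symmetric])
       (auto simp: ennreal_mult[symmetric] power_mult_distrib[symmetric] norm_mult[symmetric] right_diff_distrib)
  also have "\<dots> \<le> ennreal ((norm c)\<^sup>2) * ennreal \<delta>"
    using hP by (intro mult_left_mono) auto
  also have "\<dots> = ennreal ((norm c)\<^sup>2 * \<delta>)"
    by (simp add: ennreal_mult')
  also have "\<dots> < ennreal (((norm c)\<^sup>2 + 1) * \<delta>)" using \<open>\<delta> > 0\<close> by (intro ennreal_lessI) (auto simp: add_nonneg_pos)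
  also have "((norm c)\<^sup>2 + 1) * \<delta> = \<epsilon>"
    by (simp add: \<delta>_def add_nonneg_eq_0_iff)
  finally show "\<exists>P. complex_polynomial P \<and> (\<integral>\<^sup>+z. ennreal ((norm (c * h z - P z))\<^sup>2) \<partial>\<nu>) < ennreal \<epsilon>"
    using complex_polynomial_cmult[OF P] by blast
qed

lemma L2_approx_add:
  assumes [measurable]: "h \<in> borel_measurable borel" "g \<in> borel_measurable borel"
    and h: "L2_approx h" and g: "L2_approx g"
  shows "L2_approx (\<lambda>z. h z + g z)"
  unfolding L2_approx_def
proof (intro allI impI)
  fix \<epsilon> :: real assume \<epsilon>: "\<epsilon> > 0"
  obtain P where P: "complex_polynomial P" and hP: "(\<integral>\<^sup>+z. ennreal ((norm (h z - P z))\<^sup>2) \<partial>\<nu>) < ennreal (\<epsilon> / 4)"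
    using h \<epsilon> unfolding L2_approx_def by (meson divide_pos_pos zero_less_numeral)
  obtain Q where Q: "complex_polynomial Q" and gQ: "(\<integral>\<^sup>+z. ennreal ((norm (g z - Q z))\<^sup>2) \<partial>\<nu>) < ennreal (\<epsilon> / 4)"
    using g \<epsilon> unfolding L2_approx_def by (meson divide_pos_pos zero_less_numeral)
  note [measurable] = complex_polynomial_measurable[OF P] complex_polynomial_measurable[OF Q]
  have "(\<integral>\<^sup>+z. ennreal ((norm ((h z - P z) + (g z - Q z)))\<^sup>2) \<partial>\<nu>) < ennreal \<epsilon>"
    using hP gQ by (intro nn_integral_norm_add_power2_less) auto
  moreover have "(h z - P z) + (g z - Q z) = h z + g z - (P z + Q z)" for z by simp
  ultimately show "\<exists>P. complex_polynomial P \<and> (\<integral>\<^sup>+z. ennreal ((norm (h z + g z - P z))\<^sup>2) \<partial>\<nu>) < ennreal \<epsilon>"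
    using complex_polynomial_add[OF P Q] by (intro exI[of _ "\<lambda>z. P z + Q z"]) simp
qed

lemma L2_approx_continuous:
  fixes h :: "'a \<Rightarrow> real"
  assumes "continuous_on UNIV h"
  shows "L2_approx (\<lambda>z. complex_of_real (h z))"
  unfolding L2_approx_def
proof (intro allI impI)
  fix \<epsilon> :: real assume \<epsilon>: "\<epsilon> > 0"
  define m where "m = measure \<nu> (space \<nu>)"
  \<comment> \<open>A uniform error \<open>\<delta>\<close> on \<open>T\<close> costs at most
    \<open>\<delta>\<close> squared times the total mass \<open>m\<close>; with m + 1 in the
    denominator this stays strictly below \<open>\<epsilon>\<close>, even for zero mass.\<close>
  define \<delta> where "\<delta> = sqrt (\<epsilon> / (m + 1))"
  have m: "m \<ge> 0" by (simp add: m_def)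
  then have \<delta>: "\<delta> > 0" using \<epsilon> by (simp add: \<delta>_def)
  then obtain p where p: "real_polynomial_function p" "\<And>z. z \<in> T \<Longrightarrow> \<bar>h z - p z\<bar> < \<delta>"
    using Stone_Weierstrass_real_polynomial_function[OF compact_T continuous_on_subset[OF assms], of \<delta>] by auto
  have "(\<integral>\<^sup>+z. ennreal ((norm (complex_of_real (h z) - complex_of_real (p z)))\<^sup>2) \<partial>\<nu>) \<le> (\<integral>\<^sup>+z. ennreal (\<delta>\<^sup>2) \<partial>\<nu>)"
  proof (rule nn_integral_mono_AE)
    show "AE z in \<nu>. ennreal ((norm (complex_of_real (h z) - complex_of_real (p z)))\<^sup>2) \<le> ennreal (\<delta>\<^sup>2)"
      using AE_T
    proof eventually_elim
      case (elim z)
      then have "\<bar>h z - p z\<bar>\<^sup>2 \<le> \<delta>\<^sup>2" using p(2)[of z] by (intro power_mono) auto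
      then show ?case by (intro ennreal_leI) (simp add: of_real_diff[symmetric] del: of_real_diff)
    qed
  qed
  also have "\<dots> = ennreal (\<delta>\<^sup>2 * m)"
    by (simp add: emeasure_eq_measure m_def ennreal_mult)
  also have "\<dots> < ennreal \<epsilon>"
    using \<epsilon> m by (intro ennreal_lessI) (simp_all add: \<delta>_def divide_less_eq algebra_simps)
  finally show "\<exists>P. complex_polynomial P \<and> (\<integral>\<^sup>+z. ennreal ((norm (complex_of_real (h z) - P z))\<^sup>2) \<partial>\<nu>) < ennreal \<epsilon>"
    using p(1) \<epsilon>
    by (intro exI[of _ "\<lambda>z. complex_of_real (p z)"])
       (auto simp: complex_polynomial_def real_polynomial_function.intros(2))
qed

text \<open>The indicator is the pointwise limit of continuous tents of height 1 on \<open>K\<close>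
  with slope i in the distance to \<open>K\<close>. Nonemptiness matters because
  \<open>infdist\<close> to the empty set is 0 by convention.\<close>

lemma L2_approx_indicator_compact:
  assumes K: "compact K" "K \<noteq> {}"
  shows "L2_approx (\<lambda>z. complex_of_real (indicator K z))"
proof (rule L2_approx_limit[where s = "\<lambda>i z. complex_of_real (max 0 (1 - real i * infdist z K))" and w = "\<lambda>_. 1"])
  have K_closed: "closed K" using K by (simp add: compact_imp_closed)
  have cont: "continuous_on UNIV (\<lambda>z. max 0 (1 - real i * infdist z K))" for i
    by (intro continuous_intros)
  show "L2_approx (\<lambda>z. complex_of_real (max 0 (1 - real i * infdist z K)))" for i
    by (rule L2_approx_continuous[OF cont])
  show "(\<lambda>z. complex_of_real (max 0 (1 - real i * infdist z K))) \<in> borel_measurable borel" for i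
    using borel_measurable_continuous_onI[OF cont] by measurable
  show "(\<lambda>z. complex_of_real (indicator K z)) \<in> borel_measurable borel"
    using borel_closed[OF K_closed] by measurable
  show "(\<lambda>i. complex_of_real (max 0 (1 - real i * infdist z K))) \<longlonglongrightarrow> complex_of_real (indicator K z)" for z
  proof (cases "z \<in> K")
    case True
    then show ?thesis by simp
  next
    case False
    then have pos: "infdist z K > 0"
      using in_closed_iff_infdist_zero[OF K_closed K(2), of z] infdist_nonneg[of z K] by linarith
    obtain n :: nat where n: "1 < real n * infdist z K"
      using reals_Archimedean3[OF pos] by blast
    have "\<forall>\<^sub>F i in sequentially. complex_of_real (max 0 (1 - real i * infdist z K)) = complex_of_real (indicator K z)"
      using eventually_ge_at_top[of n]
    proof eventually_elim
      case (elim i)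
      then have "real n * infdist z K \<le> real i * infdist z K" using pos by (intro mult_right_mono) auto
      with n False show ?case by simp
    qed
    then show ?thesis by (rule tendsto_eventually)
  qed
  show "(norm (complex_of_real (indicator K z) - complex_of_real (max 0 (1 - real i * infdist z K))))\<^sup>2 \<le> 1" for i z
  proof -
    have "\<bar>indicator K z - max 0 (1 - real i * infdist z K)\<bar> \<le> 1"
      by (auto simp: indicator_def max_def infdist_nonneg)
    then show ?thesis
      by (simp add: of_real_diff[symmetric] abs_square_le_1 del: of_real_diff)
  qed
qed (auto simp: less_top[symmetric])

text \<open>Inner regularity reduces Borel sets to compact subsets of almost full measure.\<close>

lemma L2_approx_indicator:
  assumes [measurable]: "B \<in> sets borel"
  shows "L2_approx (\<lambda>z. complex_of_real (indicator B z))"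
proof (rule L2_approx_trans)
  fix \<epsilon> :: real assume \<epsilon>: "\<epsilon> > 0"
  have B: "B \<in> sets \<nu>" by simp
  show "\<exists>g. g \<in> borel_measurable borel \<and> L2_approx g \<and>
       (\<integral>\<^sup>+z. ennreal ((norm (complex_of_real (indicator B z) - g z))\<^sup>2) \<partial>\<nu>) < ennreal \<epsilon>"
  \<comment> \<open>A set of small measure is approximated by 0. Otherwise the difference of its
    measure and \<open>\<epsilon>\<close> is nonnegative, so it survives the passage to
    \<open>ennreal\<close>, and a compact subset of larger measure is nonempty.\<close>
  proof (cases "measure \<nu> B < \<epsilon>")
    case True
    have "L2_approx (\<lambda>z. complex_of_real ((\<lambda>_. 0) z))"
      by (rule L2_approx_continuous) simp
    moreover have "(\<integral>\<^sup>+z. ennreal ((norm (complex_of_real (indicator B z) - 0))\<^sup>2) \<partial>\<nu>) = (\<integral>\<^sup>+z. indicator B z \<partial>\<nu>)"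
      by (intro nn_integral_cong) (auto simp: indicator_def)
    ultimately show ?thesis
      using True B \<epsilon> by (intro exI[of _ "\<lambda>_. 0"]) (simp add: emeasure_eq_measure ennreal_lessI)
  next
    case False
    have "ennreal (measure \<nu> B - \<epsilon>) < emeasure \<nu> B"
      using False \<epsilon> by (simp add: emeasure_eq_measure ennreal_lessI)
    also have "emeasure \<nu> B = (SUP K \<in> {K. K \<subseteq> B \<and> compact K}. emeasure \<nu> K)"
      by (rule inner_regular) (auto simp: sets_eq)
    finally obtain K where K: "K \<subseteq> B" "compact K" "ennreal (measure \<nu> B - \<epsilon>) < emeasure \<nu> K"
      by (auto simp: less_SUP_iff)
    have "K \<noteq> {}" using K(3) by auto
    have [measurable]: "K \<in> sets borel" using K by (simp add: compact_imp_closed)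
    have "measure \<nu> B - \<epsilon> < measure \<nu> K"
      using K(3) False by (simp add: emeasure_eq_measure ennreal_less_iff)
    moreover have "measure \<nu> (B - K) = measure \<nu> B - measure \<nu> K"
      using K(1) by (intro finite_measure_Diff) auto
    ultimately have "measure \<nu> (B - K) < \<epsilon>" by simp
    moreover have "(\<integral>\<^sup>+z. ennreal ((norm (complex_of_real (indicator B z) - complex_of_real (indicator K z)))\<^sup>2) \<partial>\<nu>) =
        (\<integral>\<^sup>+z. indicator (B - K) z \<partial>\<nu>)"
      using K(1) by (intro nn_integral_cong) (auto simp: indicator_def)
    ultimately have "(\<integral>\<^sup>+z. ennreal ((norm (complex_of_real (indicator B z) - complex_of_real (indicator K z)))\<^sup>2) \<partial>\<nu>) < ennreal \<epsilon>"
      using \<epsilon> by (simp add: emeasure_eq_measure ennreal_lessI)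
    then show ?thesis
      using L2_approx_indicator_compact[OF K(2) \<open>K \<noteq> {}\<close>]
      by (intro exI[of _ "\<lambda>z. complex_of_real (indicator K z)"]) auto
  qed
qed measurable

lemma L2_approx_sum:
  assumes "finite S" "\<And>y. y \<in> S \<Longrightarrow> g y \<in> borel_measurable borel" "\<And>y. y \<in> S \<Longrightarrow> L2_approx (g y)"
  shows "L2_approx (\<lambda>z. \<Sum>y\<in>S. g y z)"
  using assms
proof (induction S)
  case empty
  show ?case using L2_approx_continuous[of "\<lambda>_. 0"] by simp
next
  case (insert y S)
  then show ?case by (simp add: L2_approx_add)
qed

text \<open>Simple functions are finite combinations of indicators and hence approximable; a
  sequence of them converges pointwise to \<open>h\<close> while staying below twice its
  norm.\<close>

theorem polynomials_L2_dense:
  assumes [measurable]: "h \<in> borel_measurable borel"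
    and L2: "integrable \<nu> (\<lambda>z. (norm (h z))\<^sup>2)"
  shows "L2_approx h"
proof -
  obtain F where F: "\<And>i. simple_function borel (F i)" "\<And>z. (\<lambda>i. F i z) \<longlonglongrightarrow> h z"
      "\<And>i z. dist (F i z) 0 \<le> 2 * dist (h z) 0"
    using borel_measurable_implies_sequence_metric[OF assms(1), of 0] by auto
  have [measurable]: "F i \<in> borel_measurable borel" for i
    using F(1) by (rule borel_measurable_simple_function)
  have "L2_approx (F i)" for i
  proof -
    have rep: "F i = (\<lambda>z. \<Sum>y\<in>range (F i). y * complex_of_real (indicator (F i -` {y}) z))"
    proof
      fix z
      have "F i z = (\<Sum>y\<in>F i ` space borel. indicator (F i -` {y} \<inter> space borel) z *\<^sub>R y)"
        by (rule simple_function_indicator_representation_banach[OF F(1)]) simp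
      also have "\<dots> = (\<Sum>y\<in>range (F i). y * complex_of_real (indicator (F i -` {y}) z))"
        by (intro sum.cong) (simp_all add: scaleR_conv_of_real)
      finally show "F i z = (\<Sum>y\<in>range (F i). y * complex_of_real (indicator (F i -` {y}) z))" .
    qed
    show ?thesis
    proof (subst rep, intro L2_approx_sum L2_approx_cmult L2_approx_indicator)
      show "finite (range (F i))" using simple_functionD(1)[OF F(1)[of i]] by simp
      have "F i -` {y} \<in> sets borel" for y
        using simple_functionD(2)[OF F(1)[of i], of "{y}"] by simp
      then show "F i -` {y} \<in> sets borel"
        and "(\<lambda>z. complex_of_real (indicator (F i -` {y}) z)) \<in> borel_measurable borel"
        and "(\<lambda>z. y * complex_of_real (indicator (F i -` {y}) z)) \<in> borel_measurable borel" for y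
        by auto
    qed
  qed
  then show ?thesis
  \<comment> \<open>The constant is 9 = (1 + 2)^2, from |F i z| at most 2 |h z|.\<close>
  proof (rule L2_approx_limit[rotated 2, where w = "\<lambda>z. 9 * (norm (h z))\<^sup>2"])
    show "(norm (h z - F i z))\<^sup>2 \<le> 9 * (norm (h z))\<^sup>2" for i z
    proof -
      have "norm (h z - F i z) \<le> norm (h z) + norm (F i z)" by (rule norm_triangle_ineq4)
      also have "\<dots> \<le> 3 * norm (h z)" using F(3)[of i z] by simp
      finally have "(norm (h z - F i z))\<^sup>2 \<le> (3 * norm (h z))\<^sup>2" by (intro power_mono) auto
      then show ?thesis by (simp add: power_mult_distrib)
    qed
    have "integrable \<nu> (\<lambda>z. 9 * (norm (h z))\<^sup>2)" using L2 by simp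
    then show "(\<integral>\<^sup>+z. ennreal (9 * (norm (h z))\<^sup>2) \<partial>\<nu>) < \<infinity>"
      by (subst (asm) integrable_iff_bounded) simp
  qed (use F(2) in auto)
qed

end

section \<open>Fourier coefficients on the torus\<close>

definition torus_char :: "int^'d::finite \<Rightarrow> real^'d \<Rightarrow> complex" where
  "torus_char k x = exp (\<i> * complex_of_real (\<Sum>j\<in>UNIV. real_of_int (k $ j) * x $ j))"

text \<open>Absorbs both the restriction to the cube and the normalising constant of
  \<open>L2norm\<close> and \<open>fcoeff\<close> into one probability measure, so that ordinary
  integral lemmas apply.\<close>

definition torus_measure :: "(real^'d::finite) measure" where
  "torus_measure = density (restrict_space lborel torus_cube) (\<lambda>_. ennreal ((2 * pi) powr (- real CARD('d))))"

section \<open>Transfer between the torus measure and set integrals over the cube\<close>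

lemma sets_torus_cube [measurable]: "torus_cube \<in> sets borel"
  unfolding torus_cube_def by measurable

lemma sets_torus_measure [measurable_cong, simp]: "sets torus_measure = sets (restrict_space borel torus_cube)"
  by (simp add: torus_measure_def cong: sets_restrict_space_cong)

lemma space_torus_measure [simp]: "space torus_measure = torus_cube"
  by (simp add: torus_measure_def space_restrict_space)

lemma borel_measurable_torus_measure:
  "f \<in> borel_measurable borel \<Longrightarrow> f \<in> borel_measurable torus_measure"
  by (subst measurable_cong_sets[OF sets_torus_measure refl]) (rule measurable_restrict_space1)

lemma borel_measurable_torus_measure_iff:
  fixes f :: "real^'d::finite \<Rightarrow> 'b::real_normed_vector"
  shows "f \<in> borel_measurable torus_measure \<longleftrightarrow> set_borel_measurable lborel torus_cube f"
  unfolding set_borel_measurable_def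
  by (subst measurable_cong_sets[OF sets_torus_measure refl], subst borel_measurable_restrict_space_iff) auto

lemma AE_torus_measure_iff:
  "(AE x in torus_measure. P x) \<longleftrightarrow> (AE x in lborel. x \<in> torus_cube \<longrightarrow> P x)"
  unfolding torus_measure_def
  by (subst AE_density) (auto simp: AE_restrict_space_iff)

lemma integral_torus_measure:
  fixes f :: "real^'d::finite \<Rightarrow> 'b::{banach, second_countable_topology}"
  assumes "f \<in> borel_measurable torus_measure"
  shows "integral\<^sup>L torus_measure f = (2 * pi) powr (- real CARD('d)) *\<^sub>R (LINT x:torus_cube|lborel. f x)"
proof -
  have "f \<in> borel_measurable (restrict_space lborel torus_cube)"
    using assms by (simp add: torus_measure_def)
  then show ?thesis
    unfolding torus_measure_def set_lebesgue_integral_def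
    by (subst integral_density) (auto simp: integral_restrict_space)
qed

lemma integrable_scaleR_iff:
  fixes f :: "'a \<Rightarrow> 'b::{banach, second_countable_topology}"
  assumes "c \<noteq> 0"
  shows "integrable M (\<lambda>x. c *\<^sub>R f x) \<longleftrightarrow> integrable M f"
  using assms integrable_scaleR_right[of "1 / c" M "\<lambda>x. c *\<^sub>R f x"] by auto

lemma integrable_torus_measure_iff:
  fixes f :: "real^'d::finite \<Rightarrow> 'b::{banach, second_countable_topology}"
  assumes "f \<in> borel_measurable torus_measure"
  shows "integrable torus_measure f \<longleftrightarrow> set_integrable lborel torus_cube f"
proof -
  have "f \<in> borel_measurable (restrict_space lborel torus_cube)"
    using assms by (simp add: torus_measure_def)
  then show ?thesis
    unfolding torus_measure_def set_integrable_def
    by (subst integrable_density) (auto simp: integrable_restrict_space[symmetric] integrable_scaleR_iff)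
qed

lemma emeasure_torus_cube: "emeasure lborel (torus_cube :: (real^'d::finite) set) = ennreal ((2 * pi) ^ CARD('d))"
proof -
  have "torus_cube = cbox (0::real^'d) (\<chi> j. 2 * pi)"
    by (auto simp: torus_cube_def mem_box_cart)
  then have "emeasure lborel (torus_cube :: (real^'d) set) = emeasure lborel (cbox (0::real^'d) (\<chi> j. 2 * pi))"
    by (rule arg_cong)
  also have "\<dots> = ennreal (\<Prod>b\<in>Basis. ((\<chi> j. 2 * pi) - (0::real^'d)) \<bullet> b)"
    by (rule emeasure_lborel_cbox) (auto simp: Basis_real_vec inner_axis)
  also have "\<dots> = ennreal ((2 * pi) ^ CARD('d))"
    by (simp add: prod_Basis_vec inner_axis)
  finally show ?thesis .
qed

lemma two_pi_powr_mult: "(2 * pi) powr (- real n) * (2 * pi) ^ n = 1"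
proof -
  have "(2 * pi) ^ n = (2 * pi) powr real n" by (rule powr_realpow[symmetric]) simp
  then show ?thesis by (simp only: powr_add[symmetric]) simp
qed

lemma emeasure_space_torus_measure:
  "emeasure (torus_measure :: (real^'d::finite) measure) (space torus_measure) = 1"
proof -
  have "emeasure (torus_measure :: (real^'d) measure) (space torus_measure) =
      (\<integral>\<^sup>+x. ennreal ((2 * pi) powr (- real CARD('d))) * indicator torus_cube x \<partial>(lborel :: (real^'d) measure))"
    unfolding space_torus_measure
    by (simp add: torus_measure_def emeasure_density nn_integral_restrict_space sets_restrict_space_iff)
       (auto intro!: nn_integral_cong simp: indicator_def)
  also have "\<dots> = ennreal ((2 * pi) powr (- real CARD('d))) * emeasure lborel (torus_cube :: (real^'d) set)"
    by (rule nn_integral_cmult_indicator) simp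
  also have "\<dots> = 1"
    by (simp only: emeasure_torus_cube ennreal_mult'[symmetric] powr_ge_zero two_pi_powr_mult ennreal_1)
  finally show ?thesis .
qed

lemma finite_measure_torus_measure: "finite_measure (torus_measure :: (real^'d::finite) measure)"
  by (rule finite_measureI) (simp add: emeasure_space_torus_measure del: space_torus_measure)

lemma L2T_iff: "f \<in> L2T \<longleftrightarrow> f \<in> borel_measurable torus_measure \<and> integrable torus_measure (\<lambda>x. (norm (f x))\<^sup>2)"
  using integrable_torus_measure_iff[of "\<lambda>x. (norm (f x))\<^sup>2"]
  by (auto simp: L2T_def borel_measurable_torus_measure_iff[symmetric])

lemma L2norm_eq: "f \<in> L2T \<Longrightarrow> L2norm f = sqrt (\<integral>x. (norm (f x))\<^sup>2 \<partial>torus_measure)"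
  using integral_torus_measure[of "\<lambda>x. (norm (f x))\<^sup>2"]
  by (auto simp: L2T_iff L2norm_def)

lemma L2norm_power2: "f \<in> L2T \<Longrightarrow> (L2norm f)\<^sup>2 = (\<integral>x. (norm (f x))\<^sup>2 \<partial>torus_measure)"
  by (simp add: L2norm_eq)

lemma norm_torus_char [simp]: "norm (torus_char k x) = 1"
  by (simp add: torus_char_def)

lemma torus_char_measurable [measurable]: "torus_char k \<in> borel_measurable borel"
  unfolding torus_char_def by measurable

lemma torus_char_measurable' [measurable]: "torus_char k \<in> borel_measurable torus_measure"
  by (rule borel_measurable_torus_measure) measurable

lemma cnj_torus_char: "cnj (torus_char k x) = torus_char (- k) x"
  by (simp add: torus_char_def exp_cnj sum_negf)

lemma torus_char_mult: "torus_char k x * torus_char l x = torus_char (k + l) x"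
  by (simp add: torus_char_def exp_add[symmetric] distrib_left[symmetric] sum.distrib[symmetric] distrib_right)

lemma fcoeff_eq:
  assumes "f \<in> L2T"
  shows "fcoeff f k = (\<integral>x. f x * cnj (torus_char k x) \<partial>torus_measure)"
proof -
  have [measurable]: "f \<in> borel_measurable torus_measure" using assms by (simp add: L2T_iff)
  have "exp (- \<i> * complex_of_real (\<Sum>j\<in>UNIV. real_of_int (k $ j) * x $ j)) = torus_char (- k) x" for x
    by (simp add: torus_char_def sum_negf)
  then show ?thesis
    unfolding cnj_torus_char fcoeff_def
    by (subst integral_torus_measure) (simp_all only: scaleR_conv_of_real, measurable)
qed

text \<open>For nonzero m the antiderivative exp(imy)/(im) takes equal values at 0 and 2 pi.\<close>

lemma integral_circle_char:
  fixes m :: int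
  shows "integrable lborel (\<lambda>y. indicator {0..2*pi} y *\<^sub>R exp (\<i> * complex_of_real (of_int m * y)))"
    and "(\<integral>y. indicator {0..2*pi} y *\<^sub>R exp (\<i> * complex_of_real (of_int m * y)) \<partial>lborel) = complex_of_real (if m = 0 then 2 * pi else 0)"
proof -
  show "integrable lborel (\<lambda>y. indicator {0..2*pi} y *\<^sub>R exp (\<i> * complex_of_real (of_int m * y)))"
    by (rule borel_integrable_compact) (auto intro!: continuous_intros)
  show "(\<integral>y. indicator {0..2*pi} y *\<^sub>R exp (\<i> * complex_of_real (of_int m * y)) \<partial>lborel) = complex_of_real (if m = 0 then 2 * pi else 0)"
  proof (cases "m = 0")
    case False
    define F where "F y = exp (\<i> * complex_of_real (of_int m * y)) / (\<i> * of_int m)" for y :: real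
    have "(F has_vector_derivative exp (\<i> * complex_of_real (of_int m * y))) (at y within {0..2*pi})" for y
      unfolding F_def using False
      by (auto intro!: derivative_eq_intros has_vector_derivative_real_field simp: algebra_simps)
    then have "(\<integral>y. indicator {0..2*pi} y *\<^sub>R exp (\<i> * complex_of_real (of_int m * y)) \<partial>lborel) = F (2 * pi) - F 0"
      by (intro integral_FTC_Icc) (auto intro!: continuous_intros)
    also have "exp (\<i> * complex_of_real (of_int m * (2 * pi))) = 1"
      using exp_integer_2pi[of "of_int m"] by (simp add: mult_ac)
    then have "F (2 * pi) - F 0 = 0" by (simp add: F_def)
    finally show ?thesis using False by simp
  qed (simp add: scaleR_conv_of_real)
qed

lemma integral_torus_char: "(\<integral>x. torus_char k x \<partial>torus_measure) = (if k = 0 then 1 else 0)"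
proof -
  have "(\<integral>x. torus_char k x \<partial>torus_measure) =
      (2 * pi) powr (- real CARD('a)) *\<^sub>R (\<integral>x. indicator torus_cube x *\<^sub>R torus_char k x \<partial>lborel)"
    by (subst integral_torus_measure) (auto simp: set_lebesgue_integral_def intro: borel_measurable_torus_measure)
  also have "(\<lambda>x. indicator torus_cube x *\<^sub>R torus_char k x) =
      (\<lambda>x. \<Prod>j\<in>UNIV. indicator {0..2*pi} (x $ j) *\<^sub>R exp (\<i> * complex_of_real (of_int (k $ j) * x $ j)))"
  proof
    fix x :: "real^'a"
    have "indicator torus_cube x = (\<Prod>j\<in>UNIV. indicator {0..2*pi} (x $ j) :: real)"
      by (auto simp: indicator_def torus_cube_def prod_zero_iff)
    then show "indicator torus_cube x *\<^sub>R torus_char k x =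
        (\<Prod>j\<in>UNIV. indicator {0..2*pi} (x $ j) *\<^sub>R exp (\<i> * complex_of_real (of_int (k $ j) * x $ j)))"
      by (simp add: torus_char_def scaleR_conv_of_real prod.distrib exp_sum sum_distrib_left)
  qed
  also have "integral\<^sup>L lborel \<dots> = (\<Prod>j\<in>UNIV. \<integral>y. indicator {0..2*pi} y *\<^sub>R exp (\<i> * complex_of_real (of_int (k $ j) * y)) \<partial>lborel)"
    by (rule integral_vec_prod) (rule integral_circle_char)
  also have "\<dots> = (\<Prod>j\<in>UNIV. complex_of_real (if k $ j = 0 then 2 * pi else 0))"
    by (simp only: integral_circle_char(2))
  also have "\<dots> = complex_of_real (if k = 0 then (2 * pi) ^ CARD('a) else 0)"
    by (auto simp: vec_eq_iff prod_zero_iff)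
  finally have "(\<integral>x. torus_char k x \<partial>torus_measure) =
      complex_of_real ((2 * pi) powr (- real CARD('a)) * (if k = 0 then (2 * pi) ^ CARD('a) else 0))"
    by (simp only: scaleR_conv_of_real of_real_mult)
  also have "(2 * pi) powr (- real CARD('a)) * (if k = 0 then (2 * pi) ^ CARD('a) else 0) = (if k = 0 then 1 else 0)"
    by (simp only: two_pi_powr_mult mult_zero_right split: if_split) simp
  finally show ?thesis by simp
qed

lemma borel_measurable_cnj [measurable]:
  "f \<in> borel_measurable M \<Longrightarrow> (\<lambda>x. cnj (f x)) \<in> borel_measurable M"
  by (rule measurable_compose[OF _ borel_measurable_continuous_onI]) (auto intro: continuous_intros)

lemma integrable_mult_cnj_L2T:
  assumes "f \<in> L2T" "g \<in> L2T"
  shows "integrable torus_measure (\<lambda>x. f x * cnj (g x))"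
proof -
  have [measurable]: "f \<in> borel_measurable torus_measure" "g \<in> borel_measurable torus_measure"
    using assms by (auto simp: L2T_iff)
  have "integrable torus_measure (\<lambda>x. (norm (f x))\<^sup>2 + (norm (g x))\<^sup>2)"
    using assms by (auto simp: L2T_iff)
  then show ?thesis
  proof (rule Bochner_Integration.integrable_bound)
    show "AE x in torus_measure. norm (f x * cnj (g x)) \<le> norm ((norm (f x))\<^sup>2 + (norm (g x))\<^sup>2)"
    proof (rule AE_I2)
      fix x
      have "2 * (norm (f x) * norm (g x)) \<le> (norm (f x))\<^sup>2 + (norm (g x))\<^sup>2"
        using sum_squares_bound[of "norm (f x)" "norm (g x)"] by simp
      moreover have "0 \<le> norm (f x) * norm (g x)" by simp
      ultimately have "norm (f x) * norm (g x) \<le> (norm (f x))\<^sup>2 + (norm (g x))\<^sup>2"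
        by linarith
      then show "norm (f x * cnj (g x)) \<le> norm ((norm (f x))\<^sup>2 + (norm (g x))\<^sup>2)"
        by (simp add: norm_mult)
    qed
  qed measurable
qed

lemma L2T_add:
  assumes "f \<in> L2T" "g \<in> L2T"
  shows "(\<lambda>x. f x + g x) \<in> L2T"
proof -
  have [measurable]: "f \<in> borel_measurable torus_measure" "g \<in> borel_measurable torus_measure"
    using assms by (auto simp: L2T_iff)
  have "integrable torus_measure (\<lambda>x. 2 * (norm (f x))\<^sup>2 + 2 * (norm (g x))\<^sup>2)"
    using assms by (auto simp: L2T_iff)
  then have "integrable torus_measure (\<lambda>x. (norm (f x + g x))\<^sup>2)"
    by (rule Bochner_Integration.integrable_bound) (use norm_add_power2_le in \<open>auto intro: order_trans\<close>)
  then show ?thesis by (simp add: L2T_iff)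
qed

lemma L2T_cmult: "f \<in> L2T \<Longrightarrow> (\<lambda>x. c * f x) \<in> L2T"
  by (auto simp: L2T_iff norm_mult power_mult_distrib)

lemma L2T_torus_char: "torus_char k \<in> L2T"
proof -
  interpret finite_measure torus_measure by (rule finite_measure_torus_measure)
  show ?thesis by (auto simp: L2T_iff intro: borel_measurable_torus_measure)
qed

lemma L2T_sum: "(\<And>k. k \<in> S \<Longrightarrow> f k \<in> L2T) \<Longrightarrow> (\<lambda>x. \<Sum>k\<in>S. f k x) \<in> L2T"
proof (induction S rule: infinite_finite_induct)
  case (insert k S)
  then show ?case by (simp add: L2T_add)
qed (auto simp: L2T_iff borel_measurable_torus_measure)

lemma L2T_diff: "f \<in> L2T \<Longrightarrow> g \<in> L2T \<Longrightarrow> (\<lambda>x. f x - g x) \<in> L2T"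
  using L2T_add[of f "\<lambda>x. (-1) * g x"] L2T_cmult[of g "-1"] by simp

lemma L2norm_nonneg [simp]: "L2norm f \<ge> 0"
  by (auto simp: L2norm_def set_lebesgue_integral_def intro!: mult_nonneg_nonneg integral_nonneg_AE)

text \<open>A crude form of the triangle inequality, enough to show that the supremum defining an
  operator norm is taken over a bounded set.\<close>

lemma L2norm_diff_power2_le:
  assumes "f \<in> L2T" "g \<in> L2T"
  shows "(L2norm (\<lambda>x. f x - g x))\<^sup>2 \<le> 2 * (L2norm f)\<^sup>2 + 2 * (L2norm g)\<^sup>2"
proof -
  have i: "integrable torus_measure (\<lambda>x. (norm (f x))\<^sup>2)" "integrable torus_measure (\<lambda>x. (norm (g x))\<^sup>2)"
      "integrable torus_measure (\<lambda>x. (norm (f x - g x))\<^sup>2)"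
    using assms L2T_diff[OF assms] by (auto simp: L2T_iff)
  have "(\<integral>x. (norm (f x - g x))\<^sup>2 \<partial>torus_measure) \<le> (\<integral>x. 2 * (norm (f x))\<^sup>2 + 2 * (norm (g x))\<^sup>2 \<partial>torus_measure)"
    using i norm_add_power2_le[of "f _" "- g _"] by (intro integral_mono) auto
  then show ?thesis
    using assms L2T_diff[OF assms] i by (simp add: L2norm_power2)
qed

section \<open>Trigonometric sums: orthogonality, best approximation and Bessel's inequality\<close>

definition trig_sum :: "(int^'d::finite) set \<Rightarrow> (int^'d \<Rightarrow> complex) \<Rightarrow> real^'d \<Rightarrow> complex" where
  "trig_sum \<Lambda> a x = (\<Sum>k\<in>\<Lambda>. a k * torus_char k x)"

lemma L2T_trig_sum: "trig_sum \<Lambda> a \<in> L2T"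
  unfolding trig_sum_def by (intro L2T_sum L2T_cmult L2T_torus_char)

lemma fcoeff_trig_sum:
  assumes "finite \<Lambda>"
  shows "fcoeff (trig_sum \<Lambda> a) l = (if l \<in> \<Lambda> then a l else 0)"
proof -
  have "fcoeff (trig_sum \<Lambda> a) l = (\<integral>x. (\<Sum>k\<in>\<Lambda>. a k * (torus_char k x * cnj (torus_char l x))) \<partial>torus_measure)"
    by (subst fcoeff_eq[OF L2T_trig_sum]) (simp add: trig_sum_def sum_distrib_right mult.assoc)
  also have "\<dots> = (\<Sum>k\<in>\<Lambda>. a k * (\<integral>x. torus_char k x * cnj (torus_char l x) \<partial>torus_measure))"
    by (subst Bochner_Integration.integral_sum)
       (auto intro!: integrable_mult_right integrable_mult_cnj_L2T L2T_torus_char)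
  also have "\<dots> = (\<Sum>k\<in>\<Lambda>. a k * (if k = l then 1 else 0))"
    by (simp add: cnj_torus_char torus_char_mult integral_torus_char)
  also have "\<dots> = (if l \<in> \<Lambda> then a l else 0)"
    using assms by (simp add: if_distrib cong: if_cong)
  finally show ?thesis .
qed

lemma integral_mult_cnj_trig_sum:
  assumes "finite \<Lambda>" "f \<in> L2T"
  shows "(\<integral>x. f x * cnj (trig_sum \<Lambda> a x) \<partial>torus_measure) = (\<Sum>k\<in>\<Lambda>. fcoeff f k * cnj (a k))"
proof -
  have "(\<integral>x. f x * cnj (trig_sum \<Lambda> a x) \<partial>torus_measure) =
      (\<integral>x. (\<Sum>k\<in>\<Lambda>. cnj (a k) * (f x * cnj (torus_char k x))) \<partial>torus_measure)"
    by (simp add: trig_sum_def sum_distrib_left mult_ac)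
  also have "\<dots> = (\<Sum>k\<in>\<Lambda>. cnj (a k) * (\<integral>x. f x * cnj (torus_char k x) \<partial>torus_measure))"
    using assms by (subst Bochner_Integration.integral_sum)
       (auto intro!: integrable_mult_right integrable_mult_cnj_L2T L2T_torus_char)
  finally show ?thesis using assms by (simp add: fcoeff_eq mult.commute)
qed

text \<open>Completing the square in each coefficient. The choice a = \<open>fcoeff f\<close> gives
  Bessel and the error of a partial sum; taking f to be the trigonometric sum itself gives its norm;
  for general a it shows that partial sums are best approximations.\<close>

lemma L2norm_diff_trig_sum:
  assumes \<Lambda>: "finite \<Lambda>" and f: "f \<in> L2T"
  shows "(L2norm (\<lambda>x. f x - trig_sum \<Lambda> a x))\<^sup>2 =
    (L2norm f)\<^sup>2 - (\<Sum>k\<in>\<Lambda>. (norm (fcoeff f k))\<^sup>2) + (\<Sum>k\<in>\<Lambda>. (norm (fcoeff f k - a k))\<^sup>2)"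
proof -
  let ?p = "trig_sum \<Lambda> a"
  have p: "?p \<in> L2T" by (rule L2T_trig_sum)
  have int: "integrable torus_measure (\<lambda>x. f x * cnj (?p x))" "integrable torus_measure (\<lambda>x. ?p x * cnj (?p x))"
    using f p by (auto intro: integrable_mult_cnj_L2T)
  have i2: "integrable torus_measure (\<lambda>x. (norm (f x))\<^sup>2)" using f by (simp add: L2T_iff)
  have expand: "(norm (z - w))\<^sup>2 = (norm z)\<^sup>2 - 2 * Re (z * cnj w) + Re (w * cnj w)" for z w :: complex
    by (simp add: cmod_power2) (simp add: power2_eq_square algebra_simps)
  have "(L2norm (\<lambda>x. f x - ?p x))\<^sup>2 =
      (\<integral>x. (norm (f x))\<^sup>2 - 2 * Re (f x * cnj (?p x)) + Re (?p x * cnj (?p x)) \<partial>torus_measure)"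
    using L2T_diff[OF f p] by (simp add: L2norm_power2 expand)
  also have "\<dots> = (L2norm f)\<^sup>2 - 2 * Re (\<integral>x. f x * cnj (?p x) \<partial>torus_measure) + Re (\<integral>x. ?p x * cnj (?p x) \<partial>torus_measure)"
    using int i2 integrable_Re[OF int(1)] integrable_Re[OF int(2)] f
    by (simp add: L2norm_power2 integral_Re del: complex_mult_cnj times_complex.sel)
  also have "\<dots> = (L2norm f)\<^sup>2 - (\<Sum>k\<in>\<Lambda>. 2 * Re (fcoeff f k * cnj (a k)) - Re (a k * cnj (a k)))"
    using \<Lambda> f p by (simp add: integral_mult_cnj_trig_sum fcoeff_trig_sum sum_subtractf sum_distrib_left)
  also have "(\<Sum>k\<in>\<Lambda>. 2 * Re (fcoeff f k * cnj (a k)) - Re (a k * cnj (a k))) =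
      (\<Sum>k\<in>\<Lambda>. (norm (fcoeff f k))\<^sup>2 - (norm (fcoeff f k - a k))\<^sup>2)"
    by (intro sum.cong) (auto simp: expand)
  finally show ?thesis by (simp add: sum_subtractf)
qed

lemma Bessel_torus:
  assumes "finite \<Lambda>" "f \<in> L2T"
  shows "(\<Sum>k\<in>\<Lambda>. (norm (fcoeff f k))\<^sup>2) \<le> (L2norm f)\<^sup>2"
  using L2norm_diff_trig_sum[OF assms, of "fcoeff f"] zero_le_power2[of "L2norm (\<lambda>x. f x - trig_sum \<Lambda> (fcoeff f) x)"]
  by simp

section \<open>Completeness of the trigonometric system\<close>

definition trig_poly :: "(real^'d::finite \<Rightarrow> complex) \<Rightarrow> bool" where
  "trig_poly f \<longleftrightarrow> (\<exists>\<Lambda> a. finite \<Lambda> \<and> f = trig_sum \<Lambda> a)"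

lemma trig_poly_char: "trig_poly (\<lambda>x. c * torus_char k x)"
  unfolding trig_poly_def by (rule exI[of _ "{k}"], rule exI[of _ "\<lambda>_. c"]) (auto simp: trig_sum_def)

lemma trig_poly_add:
  assumes "trig_poly f" "trig_poly g"
  shows "trig_poly (\<lambda>x. f x + g x)"
proof -
  obtain \<Lambda> a \<Lambda>' b where fin: "finite \<Lambda>" "finite \<Lambda>'" and eq: "f = trig_sum \<Lambda> a" "g = trig_sum \<Lambda>' b"
    using assms by (auto simp: trig_poly_def)
  define c where "c k = (if k \<in> \<Lambda> then a k else 0) + (if k \<in> \<Lambda>' then b k else 0)" for k
  have "f x = (\<Sum>k\<in>\<Lambda>\<union>\<Lambda>'. (if k \<in> \<Lambda> then a k else 0) * torus_char k x)"
       "g x = (\<Sum>k\<in>\<Lambda>\<union>\<Lambda>'. (if k \<in> \<Lambda>' then b k else 0) * torus_char k x)" for x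
    unfolding eq trig_sum_def using fin by (auto intro!: sum.mono_neutral_cong_left)
  then have "(\<lambda>x. f x + g x) = trig_sum (\<Lambda> \<union> \<Lambda>') c"
    by (simp add: fun_eq_iff trig_sum_def c_def sum.distrib distrib_right)
  with fin show ?thesis unfolding trig_poly_def by blast
qed

lemma trig_poly_sum:
  "(\<And>k. k \<in> S \<Longrightarrow> trig_poly (f k)) \<Longrightarrow> trig_poly (\<lambda>x. \<Sum>k\<in>S. f k x)"
proof (induction S rule: infinite_finite_induct)
  case (insert k S)
  then show ?case by (simp add: trig_poly_add)
qed (use trig_poly_char[of 0] in simp_all)

lemma trig_poly_mult:
  assumes "trig_poly f" "trig_poly g"
  shows "trig_poly (\<lambda>x. f x * g x)"
proof -
  obtain \<Lambda> a \<Lambda>' b where eq: "f = trig_sum \<Lambda> a" "g = trig_sum \<Lambda>' b"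
    using assms by (auto simp: trig_poly_def)
  have prod_eq: "(\<lambda>x. f x * g x) = (\<lambda>x. \<Sum>k\<in>\<Lambda>. \<Sum>l\<in>\<Lambda>'. (a k * b l) * torus_char (k + l) x)"
    by (simp add: eq trig_sum_def sum_product torus_char_mult[symmetric] mult_ac)
  show ?thesis
    unfolding prod_eq by (intro trig_poly_sum trig_poly_char)
qed

lemma trig_poly_const: "trig_poly (\<lambda>x. c)"
  using trig_poly_char[of c 0] by (simp add: torus_char_def)

text \<open>Glues opposite faces of the cube, so that polynomials on the image pull back to periodic
  functions; each coordinate is itself a character.\<close>

definition torus_embed :: "real^'d::finite \<Rightarrow> complex^'d" where
  "torus_embed x = (\<chi> j. exp (\<i> * complex_of_real (x $ j)))"

lemma torus_embed_nth: "torus_embed x $ j = torus_char (axis j 1) x"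
proof -
  have "real_of_int (axis j 1 $ k) * x $ k = (if k = j then x $ j else 0)" for k
    by (simp add: axis_def)
  then have "(\<Sum>k\<in>UNIV. real_of_int (axis j 1 $ k) * x $ k) = x $ j" by simp
  then show ?thesis by (simp only: torus_embed_def torus_char_def vec_lambda_beta)
qed

lemma continuous_on_torus_embed: "continuous_on S torus_embed"
  unfolding torus_embed_def by (intro continuous_intros continuous_on_vec_lambda)

lemma trig_poly_real_polynomial:
  assumes "real_polynomial_function p"
  shows "trig_poly (\<lambda>x. complex_of_real (p (torus_embed x)))"
  using assms
proof induction
  case (linear p)
  have "p (torus_embed x) = (\<Sum>b\<in>Basis. (torus_embed x \<bullet> b) * p b)" for x
    using linear_sum[OF bounded_linear.linear[OF linear], of "\<lambda>b. (torus_embed x \<bullet> b) *\<^sub>R b" Basis]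
    by (simp add: euclidean_representation linear_scale[OF bounded_linear.linear[OF linear]])
  then have expand: "(\<lambda>x. complex_of_real (p (torus_embed x))) =
      (\<lambda>x. \<Sum>b\<in>Basis. complex_of_real (torus_embed x \<bullet> b) * complex_of_real (p b))"
    by simp
  show ?case
    unfolding expand
  proof (intro trig_poly_sum trig_poly_mult trig_poly_const)
    fix b :: "complex^'a" assume "b \<in> Basis"
    then obtain j u where b: "b = axis j u" by (auto simp: Basis_vec_def)
    \<comment> \<open>The real inner product on the complex plane is Re (cnj u w), half the sum of
      that product and its conjugate. On the torus, conjugating a coordinate negates its
      frequency.\<close>
    have half: "complex_of_real (w \<bullet> u) = cnj u / 2 * w + u / 2 * cnj w" for w :: complex
      by (simp add: inner_complex_def complex_eq_iff field_simps)
    have coord: "(\<lambda>x. complex_of_real (torus_embed x \<bullet> b)) =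
        (\<lambda>x. cnj u / 2 * torus_char (axis j 1) x + u / 2 * torus_char (- axis j 1) x)"
      by (simp add: b inner_axis half torus_embed_nth cnj_torus_char)
    show "trig_poly (\<lambda>x. complex_of_real (torus_embed x \<bullet> b))"
      unfolding coord by (intro trig_poly_add trig_poly_char)
  qed
qed (simp_all add: trig_poly_const trig_poly_add trig_poly_mult)

lemma trig_poly_complex_polynomial:
  assumes "complex_polynomial P"
  shows "trig_poly (\<lambda>x. P (torus_embed x))"
proof -
  have Re_Im: "(\<lambda>x. P (torus_embed x)) =
      (\<lambda>x. complex_of_real (Re (P (torus_embed x))) + \<i> * complex_of_real (Im (P (torus_embed x))))"
    by (simp add: complex_eq[symmetric])
  show ?thesis
    using assms unfolding Re_Im complex_polynomial_def
    by (intro trig_poly_add trig_poly_mult trig_poly_const trig_poly_real_polynomial[of "\<lambda>z. Re (P z)"]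
        trig_poly_real_polynomial[of "\<lambda>z. Im (P z)"]) auto
qed

lemma borel_measurable_Arg2pi [measurable]: "Arg2pi \<in> borel_measurable borel"
  by (rule borel_measurable_iff_greater[THEN iffD2]) (auto intro: borel_open open_Arg2pi2pi_gt)

text \<open>\<open>Arg2pi\<close> inverts the embedding only where no coordinate equals 2 pi, since
  2 pi is glued to 0; the exceptional points lie in finitely many hyperplanes.\<close>

lemma AE_torus_no_boundary:
  "AE x in (torus_measure :: (real^'d::finite) measure). \<forall>j. 0 \<le> x $ j \<and> x $ j < 2 * pi"
proof -
  have "AE x in (lborel :: (real^'d) measure). x $ j \<noteq> 2 * pi" for j
  proof -
    have "{x::real^'d. x $ j = 2 * pi} \<in> null_sets lborel"
      using negligible_standard_hyperplane[of "axis j 1 :: real^'d" "2 * pi"]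
      by (simp add: inner_axis negligible_iff_null_sets null_sets_completion_iff)
    then show ?thesis by (rule AE_I') auto
  qed
  then have "AE x in (lborel :: (real^'d) measure). \<forall>j\<in>UNIV. x $ j \<noteq> 2 * pi"
    by (subst AE_finite_all) auto
  then show ?thesis
    unfolding AE_torus_measure_iff
    by eventually_elim (auto simp: torus_cube_def less_le)
qed

text \<open>The function is carried to \<open>complex^'d\<close> by taking arguments coordinatewise
  and approximated there by a polynomial in L2 of the push-forward measure; composing with the
  embedding preserves the error.\<close>

theorem trig_sum_L2_dense:
  fixes f :: "real^'d::finite \<Rightarrow> complex"
  assumes f: "f \<in> L2T" and \<epsilon>: "\<epsilon> > 0"
  shows "\<exists>\<Lambda> a. finite \<Lambda> \<and> (L2norm (\<lambda>x. f x - trig_sum \<Lambda> a x))\<^sup>2 < \<epsilon>"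
proof -
  define \<nu> where "\<nu> = distr torus_measure borel (torus_embed :: real^'d \<Rightarrow> complex^'d)"
  have E [measurable]: "torus_embed \<in> borel_measurable (torus_measure :: (real^'d) measure)"
    by (intro borel_measurable_torus_measure borel_measurable_continuous_onI continuous_on_torus_embed)
  have cube: "torus_cube = cbox (0::real^'d) (\<chi> j. 2 * pi)"
    by (auto simp: torus_cube_def mem_box_cart)
  have T: "compact (torus_embed ` (torus_cube :: (real^'d) set))"
    by (intro compact_continuous_image continuous_on_torus_embed) (simp add: cube)
  interpret compactly_supported_measure \<nu> "torus_embed ` torus_cube"
  proof (intro compactly_supported_measure.intro compactly_supported_measure_axioms.intro T)
    show "finite_measure \<nu>"
      unfolding \<nu>_def using finite_measure_torus_measure E by (rule finite_measure.finite_measure_distr)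
    show "sets \<nu> = sets borel" by (simp add: \<nu>_def)
    show "AE z in \<nu>. z \<in> torus_embed ` torus_cube"
      unfolding \<nu>_def using T
      by (subst AE_distr_iff[OF E]) (auto intro!: AE_I2 simp: borel_closed compact_imp_closed)
  qed
  have f_meas [measurable]: "f \<in> borel_measurable torus_measure" using f by (simp add: L2T_iff)
  have [measurable]: "(\<lambda>x. indicator torus_cube x *\<^sub>R f x) \<in> borel_measurable borel"
    using f by (simp add: L2T_def set_borel_measurable_def)
  \<comment> \<open>The indicator makes \<open>h\<close> Borel on the whole space, because
    \<open>f\<close> is only known to be measurable on the cube.\<close>
  define h where "h z = indicator torus_cube (\<chi> j. Arg2pi (z $ j)) *\<^sub>R f (\<chi> j. Arg2pi (z $ j))" for z :: "complex^'d"
  have [measurable]: "(\<lambda>z::complex^'d. \<chi> j. Arg2pi (z $ j)) \<in> borel_measurable borel"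
  proof -
    have "(\<lambda>z::complex^'d. Arg2pi (z $ j)) \<in> borel_measurable borel" for j
      by (rule measurable_compose[OF borel_measurable_continuous_onI borel_measurable_Arg2pi]) (intro continuous_intros)
    then show ?thesis
      by (intro borel_measurable_euclidean_space[THEN iffD2]) (auto simp: Basis_real_vec inner_axis)
  qed
  have h_meas [measurable]: "h \<in> borel_measurable borel"
    unfolding h_def by (rule measurable_compose[where f = "\<lambda>z. \<chi> j. Arg2pi (z $ j)"]) measurable
  have h: "AE x in torus_measure. h (torus_embed x) = f x"
    using AE_torus_no_boundary
  proof eventually_elim
    case (elim x)
    then have "Arg2pi (torus_embed x $ j) = x $ j" for j
      using Arg2pi_exp[of "\<i> * complex_of_real (x $ j)"] by (simp add: torus_embed_def)
    then have "(\<chi> j. Arg2pi (torus_embed x $ j)) = x" by (simp add: vec_eq_iff)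
    moreover have "x \<in> torus_cube" using elim by (auto simp: torus_cube_def less_imp_le)
    ultimately show ?case by (simp add: h_def)
  qed
  have "integrable torus_measure (\<lambda>x. (norm (h (torus_embed x)))\<^sup>2) \<longleftrightarrow> integrable torus_measure (\<lambda>x. (norm (f x))\<^sup>2)"
    by (rule integrable_cong_AE) (use h in \<open>auto elim!: eventually_mono\<close>)
  then have "integrable \<nu> (\<lambda>z. (norm (h z))\<^sup>2)"
    using f unfolding \<nu>_def by (subst integrable_distr_eq) (auto simp: L2T_iff)
  from polynomials_L2_dense[OF h_meas this] obtain P where P: "complex_polynomial P"
    "(\<integral>\<^sup>+z. ennreal ((norm (h z - P z))\<^sup>2) \<partial>\<nu>) < ennreal \<epsilon>"
    using \<epsilon> unfolding L2_approx_def by blast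
  note [measurable] = complex_polynomial_measurable[OF P(1)]
  obtain \<Lambda> a where \<Lambda>: "finite \<Lambda>" and p: "(\<lambda>x. P (torus_embed x)) = trig_sum \<Lambda> a"
    using trig_poly_complex_polynomial[OF P(1)] by (auto simp: trig_poly_def)
  let ?g = "\<lambda>x. f x - trig_sum \<Lambda> a x"
  have g: "?g \<in> L2T" by (intro L2T_diff f L2T_trig_sum)
  have "ennreal ((L2norm ?g)\<^sup>2) = (\<integral>\<^sup>+x. ennreal ((norm (?g x))\<^sup>2) \<partial>torus_measure)"
    using g by (subst nn_integral_eq_integral) (auto simp: L2norm_power2 L2T_iff)
  also have "\<dots> = (\<integral>\<^sup>+x. ennreal ((norm (h (torus_embed x) - P (torus_embed x)))\<^sup>2) \<partial>torus_measure)"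
    by (rule nn_integral_cong_AE) (use h p in \<open>auto elim!: eventually_mono simp: fun_eq_iff\<close>)
  also have "\<dots> = (\<integral>\<^sup>+z. ennreal ((norm (h z - P z))\<^sup>2) \<partial>\<nu>)"
    unfolding \<nu>_def by (subst nn_integral_distr) auto
  also have "\<dots> < ennreal \<epsilon>" by (rule P(2))
  finally have "(L2norm ?g)\<^sup>2 < \<epsilon>" using \<epsilon> by (simp add: ennreal_less_iff)
  with \<Lambda> show ?thesis by blast
qed

text \<open>Bessel bounds all finite sums from above. For the lower bound, the squared distance of
  \<open>f\<close> to any sum over \<open>\<Lambda>\<close> is at least the Bessel defect for
  \<open>\<Lambda>\<close>, and by density that distance can be made arbitrarily small.\<close>

theorem Parseval_torus:
  assumes f: "f \<in> L2T"
  shows "((\<lambda>k. (norm (fcoeff f k))\<^sup>2) has_sum (L2norm f)\<^sup>2) UNIV"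
  unfolding has_sum_def
proof (rule order_tendstoI)
  fix y assume "y < (L2norm f)\<^sup>2"
  then obtain \<Lambda> a where \<Lambda>: "finite \<Lambda>" "(L2norm (\<lambda>x. f x - trig_sum \<Lambda> a x))\<^sup>2 < (L2norm f)\<^sup>2 - y"
    using trig_sum_L2_dense[OF f, of "(L2norm f)\<^sup>2 - y"] by auto
  have "y < (\<Sum>k\<in>\<Lambda>. (norm (fcoeff f k))\<^sup>2)"
    using \<Lambda>(2) L2norm_diff_trig_sum[OF \<Lambda>(1) f, of a] sum_nonneg[of \<Lambda> "\<lambda>k. (norm (fcoeff f k - a k))\<^sup>2"]
    by simp
  moreover have "(\<Sum>k\<in>\<Lambda>. (norm (fcoeff f k))\<^sup>2) \<le> (\<Sum>k\<in>\<Lambda>'. (norm (fcoeff f k))\<^sup>2)"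
    if "finite \<Lambda>'" "\<Lambda> \<subseteq> \<Lambda>'" for \<Lambda>'
    using that by (intro sum_mono2) auto
  ultimately show "\<forall>\<^sub>F \<Lambda> in finite_subsets_at_top UNIV. y < (\<Sum>k\<in>\<Lambda>. (norm (fcoeff f k))\<^sup>2)"
    unfolding eventually_finite_subsets_at_top using \<Lambda>(1)
    by (intro exI[of _ \<Lambda>]) (auto intro: less_le_trans)
next
  fix y assume y: "(L2norm f)\<^sup>2 < y"
  show "\<forall>\<^sub>F \<Lambda> in finite_subsets_at_top UNIV. (\<Sum>k\<in>\<Lambda>. (norm (fcoeff f k))\<^sup>2) < y"
    unfolding eventually_finite_subsets_at_top
    by (intro exI[of _ "{}"]) (use y Bessel_torus[OF _ f] in \<open>auto intro: le_less_trans\<close>)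
qed

section \<open>Approximation numbers and the counting function of the weights\<close>

text \<open>Gaussian elimination by induction on the equations: an equation with only zero
  coefficients is dropped, any other one is used to eliminate one unknown.\<close>

lemma underdetermined_homogeneous_system:
  fixes c :: "'k \<Rightarrow> 'g \<Rightarrow> 'a::field"
  assumes "finite G" "finite \<Lambda>" "card G < card \<Lambda>"
  shows "\<exists>a. (\<exists>k\<in>\<Lambda>. a k \<noteq> 0) \<and> (\<forall>g\<in>G. (\<Sum>k\<in>\<Lambda>. a k * c k g) = 0)"
  using assms
proof (induction G arbitrary: \<Lambda> c rule: finite_induct)
  case empty
  then have "\<Lambda> \<noteq> {}" by auto
  then show ?case by (intro exI[of _ "\<lambda>_. 1"]) auto
next
  case (insert g G)
  show ?case
  proof (cases "\<forall>k\<in>\<Lambda>. c k g = 0")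
    case True
    have "card G < card \<Lambda>" using insert by simp
    with insert.IH[of \<Lambda> c] insert.prems obtain a where
      "\<exists>k\<in>\<Lambda>. a k \<noteq> 0" "\<forall>g\<in>G. (\<Sum>k\<in>\<Lambda>. a k * c k g) = 0" by blast
    with True show ?thesis by (intro exI[of _ a]) auto
  next
    case False
    then obtain l where l: "l \<in> \<Lambda>" "c l g \<noteq> 0" by blast
    \<comment> \<open>The coefficients after eliminating the pivot unknown \<open>l\<close>; the
      value of \<open>b l\<close> below is then the one forced by equation \<open>g\<close>.\<close>
    define c' where "c' k h = c k h - c k g / c l g * c l h" for k h
    have "card G < card (\<Lambda> - {l})" using insert l by (simp add: card_Diff_singleton)
    with insert.IH[of "\<Lambda> - {l}" c'] insert.prems obtain a where
      a: "\<exists>k\<in>\<Lambda>-{l}. a k \<noteq> 0" "\<forall>h\<in>G. (\<Sum>k\<in>\<Lambda>-{l}. a k * c' k h) = 0" by blast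
    define b where "b k = (if k = l then - (\<Sum>k\<in>\<Lambda>-{l}. a k * c k g) / c l g else a k)" for k
    have split: "(\<Sum>k\<in>\<Lambda>. b k * c k h) = b l * c l h + (\<Sum>k\<in>\<Lambda>-{l}. a k * c k h)" for h
      using l insert.prems by (simp add: sum.remove b_def)
    have "(\<Sum>k\<in>\<Lambda>. b k * c k g) = 0"
      unfolding split using l by (simp add: b_def)
    moreover have "(\<Sum>k\<in>\<Lambda>. b k * c k h) = 0" if "h \<in> G" for h
    proof -
      have "0 = (\<Sum>k\<in>\<Lambda>-{l}. a k * c' k h)" using a(2) that by simp
      also have "\<dots> = (\<Sum>k\<in>\<Lambda>-{l}. a k * c k h) - (\<Sum>k\<in>\<Lambda>-{l}. a k * c k g) / c l g * c l h"
        by (simp add: c'_def sum_subtractf algebra_simps sum_distrib_left sum_divide_distrib)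
      finally show ?thesis unfolding split by (simp add: b_def)
    qed
    moreover have "\<exists>k\<in>\<Lambda>. b k \<noteq> 0" using a(1) by (auto simp: b_def)
    ultimately show ?thesis by (intro exI[of _ b]) auto
  qed
qed

lemma sqrt_inverse_eq_powr:
  fixes t :: real
  assumes "t > 0"
  shows "sqrt (1 / t) = t powr (-1/2)"
proof -
  have "t powr (-1/2) = inverse (t powr (1/2))"
    using powr_minus[of t "1/2"] by simp
  also have "t powr (1/2) = sqrt t" using assms by (intro powr_half_sqrt) simp
  finally show ?thesis by (simp add: real_sqrt_divide inverse_eq_divide)
qed

section \<open>The Sobolev norm and its comparison with the L2 norm\<close>

lemma sob_weight_ge_1: "sob_weight R k \<ge> 1"
  by (simp add: sob_weight_def sum_nonneg)

lemma sob_weight_pos: "sob_weight R k > 0"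
  using sob_weight_ge_1[of R k] by linarith

lemma W2_L2T: "f \<in> W2 R \<Longrightarrow> f \<in> L2T"
  by (simp add: W2_def)

lemma W2norm_power2:
  "(W2norm R f)\<^sup>2 = (\<Sum>\<^sub>\<infinity>k. sob_weight R k * (norm (fcoeff f k))\<^sup>2)"
  by (simp add: W2norm_def infsum_nonneg sob_weight_pos less_imp_le)

lemma W2norm_nonneg [simp]: "W2norm R f \<ge> 0"
  by (simp add: W2norm_def infsum_nonneg sob_weight_pos less_imp_le)

lemma sum_weight_le_W2norm:
  assumes "f \<in> W2 R" "finite \<Lambda>"
  shows "(\<Sum>k\<in>\<Lambda>. sob_weight R k * (norm (fcoeff f k))\<^sup>2) \<le> (W2norm R f)\<^sup>2"
  unfolding W2norm_power2 using assms sob_weight_pos[of R]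
  by (intro finite_sum_le_infsum) (auto simp: W2_def less_imp_le)

text \<open>By Parseval only the coefficients outside \<open>\<Lambda>\<close> remain, and there
  replacing 1 by the weight divided by t can only increase the sum. With \<open>\<Lambda>\<close>
  empty and t = 1 it bounds the embedding by norm 1.\<close>

lemma L2norm_tail_le:
  assumes f: "f \<in> W2 R" and \<Lambda>: "finite \<Lambda>" and t: "t > 0" "\<And>k. k \<notin> \<Lambda> \<Longrightarrow> t \<le> sob_weight R k"
  shows "t * (L2norm (\<lambda>x. f x - trig_sum \<Lambda> (fcoeff f) x))\<^sup>2 \<le> (W2norm R f)\<^sup>2"
proof -
  have L2: "f \<in> L2T" using f by (rule W2_L2T)
  have "(L2norm (\<lambda>x. f x - trig_sum \<Lambda> (fcoeff f) x))\<^sup>2 = (L2norm f)\<^sup>2 - (\<Sum>k\<in>\<Lambda>. (norm (fcoeff f k))\<^sup>2)"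
    using L2norm_diff_trig_sum[OF \<Lambda> L2, of "fcoeff f"] by simp
  also have "\<dots> \<le> (W2norm R f)\<^sup>2 / t"
  proof -
    have "(L2norm f)\<^sup>2 \<le> (\<Sum>k\<in>\<Lambda>. (norm (fcoeff f k))\<^sup>2) + (W2norm R f)\<^sup>2 / t"
    \<comment> \<open>It suffices to bound every finite sum; the part of \<open>F\<close> inside
      \<open>\<Lambda>\<close> is bounded by the sum over \<open>\<Lambda>\<close>, the rest by the
      weighted sum.\<close>
    proof (rule has_sum_le_finite_sums[OF Parseval_torus[OF L2]])
      fix F :: "(int^'a) set" assume F: "finite F"
      have "(\<Sum>k\<in>F. (norm (fcoeff f k))\<^sup>2) \<le> (\<Sum>k\<in>\<Lambda> \<union> (F - \<Lambda>). (norm (fcoeff f k))\<^sup>2)"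
        using F \<Lambda> by (intro sum_mono2) auto
      also have "\<dots> = (\<Sum>k\<in>\<Lambda>. (norm (fcoeff f k))\<^sup>2) + (\<Sum>k\<in>F-\<Lambda>. (norm (fcoeff f k))\<^sup>2)"
        using F \<Lambda> by (intro sum.union_disjoint) auto
      also have "(\<Sum>k\<in>F-\<Lambda>. (norm (fcoeff f k))\<^sup>2) \<le> (\<Sum>k\<in>F-\<Lambda>. sob_weight R k * (norm (fcoeff f k))\<^sup>2 / t)"
        using t by (intro sum_mono) (auto simp: pos_le_divide_eq mult.commute[of _ t] intro!: mult_right_mono)
      also have "\<dots> \<le> (W2norm R f)\<^sup>2 / t"
        using t sum_weight_le_W2norm[OF f, of "F - \<Lambda>"] F
        by (simp add: sum_divide_distrib[symmetric] divide_right_mono)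
      finally show "(\<Sum>k\<in>F. (norm (fcoeff f k))\<^sup>2) \<le> (\<Sum>k\<in>\<Lambda>. (norm (fcoeff f k))\<^sup>2) + (W2norm R f)\<^sup>2 / t"
        by simp
    qed
    then show ?thesis by simp
  qed
  finally show ?thesis using t by (simp add: pos_le_divide_eq mult.commute)
qed

lemma L2norm_le_W2norm:
  assumes "f \<in> W2 R"
  shows "L2norm f \<le> W2norm R f"
proof -
  have "(L2norm f)\<^sup>2 \<le> (W2norm R f)\<^sup>2"
    using L2norm_tail_le[OF assms finite.emptyI zero_less_one sob_weight_ge_1] by (simp add: trig_sum_def)
  then show ?thesis by (rule power2_le_imp_le) simp
qed

text \<open>A real \<open>Sup\<close> is informative only for bounded sets; boundedness comes from
  the continuity clause of \<open>admissible_op\<close> together with the bounded embedding.\<close>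

lemma bdd_above_op_norm_diff:
  assumes A: "admissible_op R n A"
  shows "bdd_above {L2norm (\<lambda>x. f x - A f x) | f. f \<in> W2 R \<and> W2norm R f \<le> 1}"
proof -
  obtain C where C: "\<And>f. f \<in> W2 R \<Longrightarrow> L2norm (A f) \<le> C * W2norm R f"
    using A unfolding admissible_op_def by blast
  show ?thesis
  proof (rule bdd_aboveI)
    fix y assume "y \<in> {L2norm (\<lambda>x. f x - A f x) | f. f \<in> W2 R \<and> W2norm R f \<le> 1}"
    then obtain f where y: "y = L2norm (\<lambda>x. f x - A f x)" and f: "f \<in> W2 R" "W2norm R f \<le> 1" by blast
    have "L2norm (A f) \<le> C * W2norm R f" by (rule C[OF f(1)])
    also have "\<dots> \<le> \<bar>C\<bar> * 1" using f(2) by (intro mult_mono) auto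
    finally have "L2norm (A f) \<le> \<bar>C\<bar>" by simp
    then have "(L2norm (A f))\<^sup>2 \<le> \<bar>C\<bar>\<^sup>2" by (intro power_mono) auto
    moreover have "(L2norm f)\<^sup>2 \<le> 1\<^sup>2"
      using L2norm_le_W2norm[OF f(1)] f(2) by (intro power_mono) auto
    moreover have "A f \<in> L2T" using A f by (auto simp: admissible_op_def)
    ultimately have "y\<^sup>2 \<le> 2 + 2 * C\<^sup>2"
      using L2norm_diff_power2_le[OF W2_L2T[OF f(1)], of "A f"] y by simp
    then show "y \<le> sqrt (2 + 2 * C\<^sup>2)" by (rule real_le_rsqrt)
  qed
qed

lemma W2_trig_sum:
  assumes "finite \<Lambda>"
  shows "trig_sum \<Lambda> a \<in> W2 R"
    and "(W2norm R (trig_sum \<Lambda> a))\<^sup>2 = (\<Sum>k\<in>\<Lambda>. sob_weight R k * (norm (a k))\<^sup>2)"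
proof -
  have "((\<lambda>k. sob_weight R k * (norm (fcoeff (trig_sum \<Lambda> a) k))\<^sup>2) has_sum
      (\<Sum>k\<in>\<Lambda>. sob_weight R k * (norm (a k))\<^sup>2)) UNIV"
    using assms by (intro has_sum_finite_neutralI[of \<Lambda>]) (auto simp: fcoeff_trig_sum)
  then show "trig_sum \<Lambda> a \<in> W2 R"
    and "(W2norm R (trig_sum \<Lambda> a))\<^sup>2 = (\<Sum>k\<in>\<Lambda>. sob_weight R k * (norm (a k))\<^sup>2)"
    by (auto simp: W2_def L2T_trig_sum W2norm_power2 infsumI intro: has_sum_imp_summable)
qed

lemma L2norm_trig_sum:
  assumes "finite \<Lambda>"
  shows "(L2norm (trig_sum \<Lambda> a))\<^sup>2 = (\<Sum>k\<in>\<Lambda>. (norm (a k))\<^sup>2)"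
  using L2norm_diff_trig_sum[OF assms L2T_trig_sum[of \<Lambda> a], of a]
  by (simp add: fcoeff_trig_sum[OF assms] L2norm_def)

text \<open>Provides the lower bound 0 that the infimum in \<open>approx_num\<close> needs. The
  witness in the unit ball is the zero function, written as an empty trigonometric sum.\<close>

lemma op_norm_diff_nonneg:
  assumes "admissible_op R n A"
  shows "op_norm_diff R A \<ge> 0"
proof -
  have "trig_sum {} (\<lambda>_. 0) \<in> W2 R" "W2norm R (trig_sum {} (\<lambda>_. 0)) \<le> 1"
    using W2_trig_sum(1)[of "{}"] W2_trig_sum(2)[of "{}" R "\<lambda>_. 0"] by auto
  then have "L2norm (\<lambda>x. trig_sum {} (\<lambda>_. 0) x - A (trig_sum {} (\<lambda>_. 0)) x) \<le> op_norm_diff R A"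
    unfolding op_norm_diff_def by (intro cSup_upper bdd_above_op_norm_diff[OF assms]) blast
  with L2norm_nonneg show ?thesis by (rule order_trans)
qed

text \<open>If two characters agreed, the character of the difference of their frequencies would
  have integral 1, so the difference is 0. The rank clause of \<open>admissible_op\<close> indexes
  coefficients by functions, so a frequency must be recoverable from its character.\<close>

lemma inj_torus_char: "inj torus_char"
proof (rule injI)
  fix k l :: "int^'a" assume "torus_char k = torus_char l"
  then have "(\<lambda>x. torus_char k x * cnj (torus_char l x)) = (\<lambda>x. torus_char l x * cnj (torus_char l x))" by simp
  then have "torus_char (k - l) = (torus_char 0 :: real^'a \<Rightarrow> complex)"
    by (simp add: cnj_torus_char torus_char_mult)
  then have "(\<integral>x. torus_char (k - l) x \<partial>torus_measure) = (\<integral>x. torus_char (0::int^'a) x \<partial>torus_measure)"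
    by simp
  then show "k = l" by (simp add: integral_torus_char split: if_splits)
qed

lemma fcoeff_linear:
  assumes "f \<in> L2T" "g \<in> L2T"
  shows "fcoeff (\<lambda>y. a * f y + b * g y) k = a * fcoeff f k + b * fcoeff g k"
proof -
  have "integrable torus_measure (\<lambda>x. f x * cnj (torus_char k x))" "integrable torus_measure (\<lambda>x. g x * cnj (torus_char k x))"
    using assms by (auto intro: integrable_mult_cnj_L2T L2T_torus_char)
  then show ?thesis
    using assms by (simp add: fcoeff_eq L2T_add L2T_cmult distrib_right mult.assoc)
qed

lemma admissible_partial_sum:
  assumes \<Lambda>: "finite \<Lambda>" "card \<Lambda> < n"
  shows "admissible_op R n (\<lambda>f. trig_sum \<Lambda> (fcoeff f))"
  unfolding admissible_op_def
proof (intro conjI ballI allI)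
  show "trig_sum \<Lambda> (fcoeff f) \<in> L2T" for f by (rule L2T_trig_sum)
  show "AE x in lborel. x \<in> torus_cube \<longrightarrow> trig_sum \<Lambda> (fcoeff (\<lambda>y. a * f y + b * g y)) x =
      a * trig_sum \<Lambda> (fcoeff f) x + b * trig_sum \<Lambda> (fcoeff g) x" if "f \<in> W2 R" "g \<in> W2 R" for f g a b
    using that by (intro always_eventually)
      (simp add: trig_sum_def fcoeff_linear W2_L2T sum_distrib_left sum.distrib distrib_right mult.assoc)
  show "\<exists>C. \<forall>f\<in>W2 R. L2norm (trig_sum \<Lambda> (fcoeff f)) \<le> C * W2norm R f"
  proof (intro exI[of _ 1] ballI)
    fix f assume f: "f \<in> W2 R"
    have "(L2norm (trig_sum \<Lambda> (fcoeff f)))\<^sup>2 \<le> (L2norm f)\<^sup>2"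
      using Bessel_torus[OF \<Lambda>(1) W2_L2T[OF f]] by (simp add: L2norm_trig_sum \<Lambda>)
    then have "L2norm (trig_sum \<Lambda> (fcoeff f)) \<le> L2norm f" by (rule power2_le_imp_le) simp
    also have "\<dots> \<le> W2norm R f" by (rule L2norm_le_W2norm[OF f])
    finally show "L2norm (trig_sum \<Lambda> (fcoeff f)) \<le> 1 * W2norm R f" by simp
  qed
  show "\<exists>G. finite G \<and> card G < n \<and> G \<subseteq> L2T \<and>
     (\<forall>f\<in>W2 R. \<exists>c. AE x in lborel. x \<in> torus_cube \<longrightarrow> trig_sum \<Lambda> (fcoeff f) x = (\<Sum>g\<in>G. c g * g x))"
  proof (intro exI[of _ "torus_char ` \<Lambda>"] conjI ballI)
    have inj: "inj_on torus_char \<Lambda>" using inj_torus_char by (rule inj_on_subset) simp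
    show "finite (torus_char ` \<Lambda>)" "torus_char ` \<Lambda> \<subseteq> L2T" "card (torus_char ` \<Lambda>) < n"
      using \<Lambda> inj by (auto simp: L2T_torus_char card_image)
    show "\<exists>c. AE x in lborel. x \<in> torus_cube \<longrightarrow> trig_sum \<Lambda> (fcoeff f) x = (\<Sum>g\<in>torus_char ` \<Lambda>. c g * g x)" for f
      by (intro exI[of _ "\<lambda>g. fcoeff f (the_inv torus_char g)"] always_eventually)
         (simp add: trig_sum_def sum.reindex[OF inj] the_inv_f_f[OF inj_torus_char])
  qed
qed

section \<open>Upper and lower bounds for the approximation numbers\<close>

theorem approx_num_le:
  assumes \<Lambda>: "finite {k. sob_weight R k \<le> t}" "card {k. sob_weight R k \<le> t} < n" and t: "t > 0"
  shows "approx_num R n \<le> t powr (-1/2)"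
proof -
  let ?\<Lambda> = "{k. sob_weight R k \<le> t}"
  let ?A = "\<lambda>f. trig_sum ?\<Lambda> (fcoeff f)"
  have adm: "admissible_op R n ?A" by (rule admissible_partial_sum[OF \<Lambda>])
  have "approx_num R n \<le> op_norm_diff R ?A"
    unfolding approx_num_def
  proof (rule cInf_lower)
    show "bdd_below {op_norm_diff R A |A. admissible_op R n A}"
      by (rule bdd_belowI[of _ 0]) (auto intro: op_norm_diff_nonneg)
  qed (use adm in blast)
  also have "\<dots> \<le> t powr (-1/2)"
    unfolding op_norm_diff_def
  proof (rule cSup_least)
    have "trig_sum {} (\<lambda>_. 0) \<in> W2 R" "W2norm R (trig_sum {} (\<lambda>_. 0)) \<le> 1"
      using W2_trig_sum(1)[of "{}"] W2_trig_sum(2)[of "{}" R "\<lambda>_. 0"] by auto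
    then show "{L2norm (\<lambda>x. f x - ?A f x) |f. f \<in> W2 R \<and> W2norm R f \<le> 1} \<noteq> {}" by blast
    fix y assume "y \<in> {L2norm (\<lambda>x. f x - ?A f x) |f. f \<in> W2 R \<and> W2norm R f \<le> 1}"
    then obtain f where y: "y = L2norm (\<lambda>x. f x - ?A f x)" and f: "f \<in> W2 R" "W2norm R f \<le> 1" by blast
    have "t * y\<^sup>2 \<le> (W2norm R f)\<^sup>2"
      unfolding y by (rule L2norm_tail_le[OF f(1) \<Lambda>(1) t]) auto
    also have "\<dots> \<le> 1" using f(2) by (simp add: power_le_one)
    finally have "y\<^sup>2 \<le> 1 / t" using t by (simp add: field_simps)
    then have "y \<le> sqrt (1 / t)" by (rule real_le_rsqrt)
    also have "sqrt (1 / t) = t powr (-1/2)"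
      using t by (rule sqrt_inverse_eq_powr)
    finally show "y \<le> t powr (-1/2)" .
  qed
  finally show ?thesis .
qed

text \<open>An operator of rank less than \<open>card \<Lambda>\<close> annihilates a nonzero trigonometric sum with frequencies in \<open>\<Lambda>\<close>.\<close>
lemma op_norm_diff_ge:
  assumes A: "admissible_op R n A" and \<Lambda>: "finite \<Lambda>" "n \<le> card \<Lambda>" "\<And>k. k \<in> \<Lambda> \<Longrightarrow> sob_weight R k \<le> t"
    and t: "t > 0"
  shows "t powr (-1/2) \<le> op_norm_diff R A"
proof -
  obtain G where G: "finite G" "card G < n"
    and rank: "\<And>f. f \<in> W2 R \<Longrightarrow> \<exists>c. AE x in torus_measure. A f x = (\<Sum>g\<in>G. c g * g x)"
    using A unfolding admissible_op_def AE_torus_measure_iff by blast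
  have lin: "AE x in torus_measure. A (\<lambda>y. a * f y + b * g y) x = a * A f x + b * A g x"
    if "f \<in> W2 R" "g \<in> W2 R" for f g a b
    using A that unfolding admissible_op_def AE_torus_measure_iff by blast
  \<comment> \<open>\<open>G\<close> may be linearly dependent, so the coefficients supplied by the
    rank clause need not depend linearly on the function. One choice is fixed for each character and
    extended to sums through the linearity of \<open>A\<close>.\<close>
  have "\<exists>c. AE x in torus_measure. A (trig_sum {k} (\<lambda>_. 1)) x = (\<Sum>g\<in>G. c g * g x)" for k
    by (rule rank) (rule W2_trig_sum(1), simp)
  then have "\<exists>c. \<forall>k. AE x in torus_measure. A (trig_sum {k} (\<lambda>_. 1)) x = (\<Sum>g\<in>G. c k g * g x)"
    by (intro choice allI)
  then obtain c where c: "\<And>k. AE x in torus_measure. A (trig_sum {k} (\<lambda>_. 1)) x = (\<Sum>g\<in>G. c k g * g x)"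
    by blast
  have image: "AE x in torus_measure. A (trig_sum F a) x = (\<Sum>k\<in>F. a k * (\<Sum>g\<in>G. c k g * g x))"
    if "finite F" for F a
    using that
  proof induction
    case empty
    \<comment> \<open>That \<open>A\<close> sends 0 to 0 almost everywhere is drawn from the
      linearity clause with both scalars 0.\<close>
    have "AE x in torus_measure. A (\<lambda>y. 0 * trig_sum {} a y + 0 * trig_sum {} a y) x =
        0 * A (trig_sum {} a) x + 0 * A (trig_sum {} a) x"
      by (intro lin W2_trig_sum(1)) auto
    then show ?case by (simp add: trig_sum_def)
  next
    case (insert k F)
    have "AE x in torus_measure. A (\<lambda>y. a k * trig_sum {k} (\<lambda>_. 1) y + 1 * trig_sum F a y) x =
        a k * A (trig_sum {k} (\<lambda>_. 1)) x + 1 * A (trig_sum F a) x"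
      using insert by (intro lin W2_trig_sum(1)) auto
    moreover have "(\<lambda>y. a k * trig_sum {k} (\<lambda>_. 1) y + 1 * trig_sum F a y) = trig_sum (insert k F) a"
      using insert by (simp add: trig_sum_def fun_eq_iff)
    ultimately have "AE x in torus_measure. A (trig_sum (insert k F) a) x =
        a k * A (trig_sum {k} (\<lambda>_. 1)) x + A (trig_sum F a) x" by simp
    then show ?case
      using insert.IH c[of k]
    proof eventually_elim
      case (elim x)
      then show ?case using insert.hyps by simp
    qed
  qed
  \<comment> \<open>One homogeneous equation for each element of \<open>G\<close>, one unknown for
    each frequency: fewer than n equations against at least n unknowns.\<close>
  obtain a where a: "\<exists>k\<in>\<Lambda>. a k \<noteq> 0" "\<forall>g\<in>G. (\<Sum>k\<in>\<Lambda>. a k * c k g) = 0"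
    using underdetermined_homogeneous_system[OF G(1) \<Lambda>(1) less_le_trans[OF G(2) \<Lambda>(2)], of c] by blast
  define Q where "Q = (\<Sum>k\<in>\<Lambda>. sob_weight R k * (norm (a k))\<^sup>2)"
  define S where "S = sqrt Q"
  have "Q > 0"
  proof -
    from a(1) obtain l where l: "l \<in> \<Lambda>" "a l \<noteq> 0" by blast
    then show ?thesis
      unfolding Q_def by (intro sum_pos2[OF \<Lambda>(1) l(1)]) (auto simp: sob_weight_pos less_imp_le)
  qed
  then have S: "S > 0" "S\<^sup>2 = Q"
    by (auto simp: S_def)
  \<comment> \<open>Dividing by \<open>S\<close> puts the sum on the unit sphere of the Sobolev
    space without disturbing the homogeneous equations.\<close>
  define f where "f = trig_sum \<Lambda> (\<lambda>k. a k / S)"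
  have f: "f \<in> W2 R" unfolding f_def by (rule W2_trig_sum[OF \<Lambda>(1)])
  have "(W2norm R f)\<^sup>2 = Q / S\<^sup>2"
    using S(1) by (simp add: Q_def f_def W2_trig_sum[OF \<Lambda>(1)] norm_divide power_divide sum_divide_distrib)
  then have f_norm: "(W2norm R f)\<^sup>2 = 1" using S \<open>Q > 0\<close> by simp
  then have f_le: "W2norm R f \<le> 1" by (auto intro: power2_le_imp_le[of _ 1])
  have "1 \<le> t * (L2norm f)\<^sup>2"
  proof -
    have "(W2norm R f)\<^sup>2 \<le> (\<Sum>k\<in>\<Lambda>. t * (norm (a k / S))\<^sup>2)"
      unfolding f_def W2_trig_sum(2)[OF \<Lambda>(1)] using \<Lambda>(3) by (intro sum_mono mult_right_mono) auto
    then have "1 \<le> (\<Sum>k\<in>\<Lambda>. t * (norm (a k / S))\<^sup>2)" unfolding f_norm .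
    then show ?thesis
      by (simp add: sum_distrib_left[symmetric] L2norm_trig_sum[OF \<Lambda>(1)] f_def)
  qed
  then have "1 / t \<le> (L2norm f)\<^sup>2" using t by (simp add: pos_divide_le_eq mult.commute)
  then have "sqrt (1 / t) \<le> sqrt ((L2norm f)\<^sup>2)" by (rule real_sqrt_le_mono)
  then have "sqrt (1 / t) \<le> L2norm f" by simp
  have Af: "AE x in torus_measure. A f x = 0"
    using image[OF \<Lambda>(1), of "\<lambda>k. a k / S"]
  proof eventually_elim
    case (elim x)
    have "A f x = (\<Sum>k\<in>\<Lambda>. \<Sum>g\<in>G. (a k / S) * (c k g * g x))"
      unfolding f_def elim sum_distrib_left ..
    also have "\<dots> = (\<Sum>g\<in>G. (g x / S) * (\<Sum>k\<in>\<Lambda>. a k * c k g))"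
      by (subst sum.swap) (simp add: sum_distrib_left mult.commute mult.left_commute)
    also have "\<dots> = 0" using a(2) by simp
    finally show ?case .
  qed
  have Af_L2: "A f \<in> L2T" using A f by (simp add: admissible_op_def)
  have "(L2norm (\<lambda>x. f x - A f x))\<^sup>2 = (L2norm f)\<^sup>2"
    unfolding L2norm_power2[OF W2_L2T[OF f]] L2norm_power2[OF L2T_diff[OF W2_L2T[OF f] Af_L2]]
  proof (rule integral_cong_AE)
    show "AE x in torus_measure. (norm (f x - A f x))\<^sup>2 = (norm (f x))\<^sup>2"
      using Af by eventually_elim simp
  qed (use W2_L2T[OF f] Af_L2 in \<open>auto simp: L2T_iff\<close>)
  then have "L2norm (\<lambda>x. f x - A f x) = L2norm f" by simp
  moreover have "L2norm (\<lambda>x. f x - A f x) \<le> op_norm_diff R A"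
    unfolding op_norm_diff_def using f f_le by (intro cSup_upper bdd_above_op_norm_diff[OF A]) blast
  moreover have "sqrt (1 / t) = t powr (-1/2)"
    using t by (rule sqrt_inverse_eq_powr)
  ultimately show ?thesis using \<open>sqrt (1 / t) \<le> L2norm f\<close> by simp
qed

theorem approx_num_ge:
  assumes \<Lambda>: "finite {k. sob_weight R k \<le> t}" "n \<le> card {k. sob_weight R k \<le> t}" and t: "t > 0" and n: "n > 0"
  shows "t powr (-1/2) \<le> approx_num R n"
  unfolding approx_num_def
proof (rule cInf_greatest)
  \<comment> \<open>The partial sum over no frequencies has rank 0, hence is admissible as soon as n
    is positive; the infimum is over a nonempty set.\<close>
  show "{op_norm_diff R A |A. admissible_op R n A} \<noteq> {}"
    using admissible_partial_sum[of "{}" n R] n by auto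
  show "t powr (-1/2) \<le> y" if "y \<in> {op_norm_diff R A |A. admissible_op R n A}" for y
    using that op_norm_diff_ge[OF _ \<Lambda> _ t] by auto
qed

section \<open>The limit\<close>

lemma sob_weight_le_iff:
  "sob_weight R k \<le> t \<longleftrightarrow> (\<Sum>j\<in>UNIV. \<bar>real_of_int (k $ j)\<bar> powr ((2 *\<^sub>R R) $ j)) \<le> t - 1"
  by (auto simp: sob_weight_def)

lemma finite_sob_weight_le:
  assumes "\<And>j. R $ j > 0"
  shows "finite {k. sob_weight R k \<le> t}"
  unfolding sob_weight_le_iff by (rule finite_lattice_powr_sum) (simp add: assms)

text \<open>The constant 1 in the weight shifts the threshold from t to t - 1, and ((t - 1)/t)^D
  tends to 1, so the asymptotics of the lattice count are unchanged.\<close>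

lemma sob_weight_count_asymp:
  fixes R :: "real^'d::finite"
  assumes R: "\<And>j. R $ j > 0"
  shows "((\<lambda>t. real (card {k. sob_weight R k \<le> t}) / t powr (\<Sum>j\<in>UNIV. 1 / (2 * R $ j)))
    \<longlongrightarrow> measure lborel (ballS (2 *\<^sub>R R))) at_top"
proof -
  define D where "D = (\<Sum>j\<in>UNIV. 1 / (2 * R $ j))"
  define N where "N t = real (card {k. sob_weight R k \<le> t})" for t
  have shift: "filterlim (\<lambda>t::real. t - 1) at_top at_top"
    using filterlim_tendsto_add_at_top[OF tendsto_const[of "-1::real"] filterlim_ident] by simp
  have "((\<lambda>s. N (s + 1) / s powr D) \<longlongrightarrow> measure lborel (ballS (2 *\<^sub>R R))) at_top"
    using lattice_count_powr_sum[of "2 *\<^sub>R R"] R by (simp add: N_def D_def sob_weight_le_iff)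
  from filterlim_compose[OF this shift]
  have lim: "((\<lambda>t. N t / (t - 1) powr D) \<longlongrightarrow> measure lborel (ballS (2 *\<^sub>R R))) at_top" by simp
  have "((\<lambda>t::real. 1 / t) \<longlongrightarrow> 0) at_top"
    using tendsto_inverse_0_at_top[OF filterlim_ident] by (simp add: inverse_eq_divide)
  then have "((\<lambda>t::real. (1 - 1 / t) powr D) \<longlongrightarrow> (1 - 0) powr D) at_top"
    by (intro tendsto_intros) auto
  from tendsto_mult[OF lim this]
  have "((\<lambda>t. N t / (t - 1) powr D * (1 - 1 / t) powr D) \<longlongrightarrow> measure lborel (ballS (2 *\<^sub>R R))) at_top"
    by simp
  moreover have "\<forall>\<^sub>F t in at_top. N t / (t - 1) powr D * (1 - 1 / t) powr D = N t / t powr D"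
    using eventually_gt_at_top[of 1]
  proof eventually_elim
    case (elim t)
    then have "1 - 1 / t = (t - 1) / t" by (simp add: field_simps)
    then have "(1 - 1 / t) powr D = (t - 1) powr D / t powr D" using elim by (simp add: powr_divide)
    with elim show ?case by simp
  qed
  ultimately show ?thesis unfolding N_def D_def by (rule Lim_transform_eventually)
qed

text \<open>The threshold is the solution \<open>t\<close> of \<open>b * t powr (\<Sum>j. 1 / (2 * R $ j)) = n\<close>.\<close>
lemma sob_weight_count_ratio:
  fixes R :: "real^'d::finite"
  assumes R: "\<And>j. R $ j > 0" and b: "b > 0"
  shows "(\<lambda>n. real (card {k. sob_weight R k \<le> (real n / b) powr (2 * gR R)}) / real n)
    \<longlonglongrightarrow> measure lborel (ballS (2 *\<^sub>R R)) / b"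
proof -
  define D where "D = (\<Sum>j\<in>UNIV. 1 / (2 * R $ j))"
  have D: "D > 0" using R by (auto simp: D_def intro!: sum_pos)
  have "gR R = 1 / (2 * D)"
    by (simp add: gR_def D_def sum_distrib_left)
  \<comment> \<open>This identity makes the D-th power of the threshold equal to n/b, so the count
    asymptotics can be read off along the sequence.\<close>
  then have g: "2 * gR R * D = 1" "2 * gR R > 0" using D by auto
  have "filterlim (\<lambda>n. real n / b) at_top sequentially"
    using b filterlim_tendsto_pos_mult_at_top[OF tendsto_const[of "1 / b"] _ filterlim_real_sequentially] by simp
  from filterlim_compose[OF filterlim_powr_at_top[OF g(2)] this]
  have "filterlim (\<lambda>n. (real n / b) powr (2 * gR R)) at_top sequentially" .
  from filterlim_compose[OF sob_weight_count_asymp[of R, OF R, folded D_def] this]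
  have "(\<lambda>n. real (card {k. sob_weight R k \<le> (real n / b) powr (2 * gR R)}) / (real n / b))
    \<longlonglongrightarrow> measure lborel (ballS (2 *\<^sub>R R))"
    using b by (simp add: powr_powr g(1))
  from tendsto_divide[OF this tendsto_const[of b]] b show ?thesis by simp
qed

lemma powr_rescale_cancel:
  assumes "b > 0" "n > (0::nat)"
  shows "real n powr g * ((real n / b) powr (2 * g)) powr (-1/2) = b powr g"
proof -
  have "((real n / b) powr (2 * g)) powr (-1/2) = (real n / b) powr (- g)" by (simp add: powr_powr)
  also have "\<dots> = b powr g / real n powr g"
    using assms by (simp add: powr_minus powr_divide)
  finally show ?thesis using assms by simp
qed

text \<open>For b > V the count at the threshold (n/b)^(2g), divided by n, tends to V/b < 1, so
  truncation there eventually has rank below n.\<close>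

lemma approx_num_eventually_le:
  fixes R :: "real^'d::finite"
  assumes R: "\<And>j. R $ j > 0" and b: "b > measure lborel (ballS (2 *\<^sub>R R))"
  shows "\<forall>\<^sub>F n in sequentially. real n powr gR R * approx_num R n \<le> b powr gR R"
proof -
  have b0: "b > 0" using b measure_nonneg[of lborel "ballS (2 *\<^sub>R R)"] by linarith
  have "measure lborel (ballS (2 *\<^sub>R R)) / b < 1" using b b0 by simp
  from order_tendstoD(2)[OF sob_weight_count_ratio[of R, OF R b0] this] eventually_gt_at_top[of 0]
  show ?thesis
  proof eventually_elim
    case (elim n)
    then have "card {k. sob_weight R k \<le> (real n / b) powr (2 * gR R)} < n" by simp
    then have "approx_num R n \<le> ((real n / b) powr (2 * gR R)) powr (-1/2)"
      using elim b0 by (intro approx_num_le finite_sob_weight_le R) auto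
    then have "real n powr gR R * approx_num R n \<le> real n powr gR R * ((real n / b) powr (2 * gR R)) powr (-1/2)"
      by (rule mult_left_mono) simp
    then show ?case using elim b0 by (simp only: powr_rescale_cancel)
  qed
qed

text \<open>For b < V the ratio of the count to n tends to V/b > 1, so eventually at least n
  frequencies lie below the threshold and no operator of rank below n can handle them all.\<close>

lemma approx_num_eventually_ge:
  fixes R :: "real^'d::finite"
  assumes R: "\<And>j. R $ j > 0" and b: "0 < b" "b < measure lborel (ballS (2 *\<^sub>R R))"
  shows "\<forall>\<^sub>F n in sequentially. b powr gR R \<le> real n powr gR R * approx_num R n"
proof -
  have "1 < measure lborel (ballS (2 *\<^sub>R R)) / b" using b by simp
  from order_tendstoD(1)[OF sob_weight_count_ratio[of R, OF R b(1)] this] eventually_gt_at_top[of 0]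
  show ?thesis
  proof eventually_elim
    case (elim n)
    then have "n \<le> card {k. sob_weight R k \<le> (real n / b) powr (2 * gR R)}" by simp
    then have "((real n / b) powr (2 * gR R)) powr (-1/2) \<le> approx_num R n"
      using elim b by (intro approx_num_ge finite_sob_weight_le R) auto
    then have "real n powr gR R * ((real n / b) powr (2 * gR R)) powr (-1/2) \<le> real n powr gR R * approx_num R n"
      by (rule mult_left_mono) simp
    then show ?case using elim b by (simp only: powr_rescale_cancel)
  qed
qed

theorem theorem2p2:
  fixes R :: "real^'d::finite"
  assumes "\<forall>j. R$j > 0"
  shows "(\<lambda>n. real n powr gR R * approx_num R n)
           \<longlonglongrightarrow> (measure lborel (ballS (2 *\<^sub>R R))) powr gR R
       \<and> measure lborel (ballS (2 *\<^sub>R R)) =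
           2 ^ CARD('d) * (\<Prod>j\<in>UNIV. Gamma (1 + 1 / (2 * R$j)))
             / Gamma (1 + (\<Sum>j\<in>UNIV. 1 / (2 * R$j)))"
proof
  have R: "R $ j > 0" "(2 *\<^sub>R R) $ j > 0" for j using assms by auto
  define V where "V = measure lborel (ballS (2 *\<^sub>R R))"
  have V: "V > 0" unfolding V_def by (rule measure_ballS_pos[OF R(2)])
  \<comment> \<open>Positivity of V gives continuity of the power at V and leaves room for positive
    b below V; the two one-sided filters supply the b needed for each half of the limit.\<close>
  have cont: "((\<lambda>b. b powr gR R) \<longlongrightarrow> V powr gR R) (at V within S)" for S
    using V by (intro tendsto_intros) auto
  show "(\<lambda>n. real n powr gR R * approx_num R n) \<longlonglongrightarrow> (measure lborel (ballS (2 *\<^sub>R R))) powr gR R"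
    unfolding V_def[symmetric]
  proof (rule order_tendstoI)
    fix y assume "y < V powr gR R"
    then have "\<forall>\<^sub>F b in at_left V. y < b powr gR R" by (rule order_tendstoD(1)[OF cont])
    moreover have "\<forall>\<^sub>F b in at_left V. b \<in> {0<..<V}" by (rule eventually_at_left_real[OF V])
    ultimately have "\<forall>\<^sub>F b in at_left V. y < b powr gR R \<and> b \<in> {0<..<V}" by (rule eventually_conj)
    then obtain b where "y < b powr gR R" "0 < b" "b < V"
      using eventually_happens[of _ "at_left V"] by auto
    then show "\<forall>\<^sub>F n in sequentially. y < real n powr gR R * approx_num R n"
      using approx_num_eventually_ge[of R b, OF R(1)] unfolding V_def
      by (auto elim!: eventually_mono)
  next
    fix y assume "V powr gR R < y"
    then have "\<forall>\<^sub>F b in at_right V. b powr gR R < y" by (rule order_tendstoD(2)[OF cont])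
    moreover have "\<forall>\<^sub>F b in at_right V. b \<in> {V<..<V+1}" by (rule eventually_at_right_real) simp
    ultimately have "\<forall>\<^sub>F b in at_right V. b powr gR R < y \<and> b \<in> {V<..<V+1}" by (rule eventually_conj)
    then obtain b where "b powr gR R < y" "V < b"
      using eventually_happens[of _ "at_right V"] by auto
    then show "\<forall>\<^sub>F n in sequentially. real n powr gR R * approx_num R n < y"
      using approx_num_eventually_le[of R b, OF R(1)] unfolding V_def
      by (auto elim!: eventually_mono)
  qed
  show "measure lborel (ballS (2 *\<^sub>R R)) =
           2 ^ CARD('d) * (\<Prod>j\<in>UNIV. Gamma (1 + 1 / (2 * R$j)))
             / Gamma (1 + (\<Sum>j\<in>UNIV. 1 / (2 * R$j)))"
    using measure_ballS[OF R(2)] by simp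
qed

end
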